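(* (Bounded Norm Convergence Theorem) Let $E,F$ be Banach spaces and let $\mu\colon\mathfrak{M}\to\mathcal{L}(E,F)$ be an i-measure, where $\mathfrak{M}$ is a $\sigma$-algebra on a set $Z$. If $f_n\in M_{\mathfrak{M}}(Z,E)$ are uniformly bounded and converge pointwise to $f\colon Z\to E$ in the norm topology of $E$, then $\int_Z f_n\,\mathrm{d}\mu$ converge to $\int_Z f\,\mathrm{d}\mu$ in the norm topology of $F$.
   Context: Banach spaces are over a fixed field $\mathbb{K}$ of real or complex numbers; $\mathcal{L}(E,F)$ is the Banach space of continuous linear operators $E\to F$. For $T_n\in\mathcal{L}(E,F)$, the series $\sum_n T_n$ is independently convergent if $\sum_n T_nx_n$ converges in the norm of $F$ for every bounded sequence $(x_n)$ in $E$. A set function $\mu\colon\mathfrak{M}\to\mathcal{L}(E,F)$ is an i-measure if for any sequence of pairwise disjoint sets $A_n\in\mathfrak{M}$, $\mu(\bigcup_n A_n)x=\sum_n\mu(A_n)x$ for each $x\in E$ and $\sum_n\mu(A_n)$ is independently convergent. Its total semivariation $\|\mu\|_Z$ is the supremum of $\|\sum_{n=1}^N\mu(A_n)x_n\|$ over all finite $N$, pairwise disjoint $A_n\in\mathfrak{M}$ and $x_n\in E$ with $\|x_n\|\le1$; it is known to be finite for every i-measure. $\ell_\infty(Z,E)$ is the space of bounded functions $Z\to E$ with the sup-norm. $M_{\mathfrak{M}}(Z,E)$ is the subspace of all bounded $f\colon Z\to E$ such that $f(Z)$ is separable and $\psi\circ f$ is $\mathfrak{M}$-measurable for each $\psi\in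 E^*$ (a pointwise limit of a uniformly bounded sequence from this space again belongs to it). $S_{\mathfrak{M}}(Z,E)$ is the set of $f\in\ell_\infty(Z,E)$ with $f(Z)$ countable and $f^{-1}(\{e\})\in\mathfrak{M}$ for all $e\in E$; for such $f$, $\int_Z f\,\mathrm{d}\mu=\sum_{e\in E}\mu(f^{-1}(\{e\}))e$ (unconditionally convergent). The uniform closure of $S_{\mathfrak{M}}(Z,E)$ is $M_{\mathfrak{M}}(Z,E)$; the map $f\mapsto\int_Zf\,\mathrm{d}\mu$ is linear and continuous on $S_{\mathfrak{M}}(Z,E)$ with norm $\|\mu\|_Z$, and on $M_{\mathfrak{M}}(Z,E)$ the integral is defined as its unique continuous extension. *)

theory Defs
  imports "HOL-Analysis.Analysis"
begin

definition (in real_normed_field) isometric_field_iso :: "('a \<Rightarrow> 'b::real_normed_field) \<Rightarrow> bool"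
  where "isometric_field_iso h \<longleftrightarrow> bij h \<and>
    (\<forall>x y. h (x + y) = h x + h y) \<and> (\<forall>x y. h (x * y) = h x * h y) \<and>
    (\<forall>r x. h (r *\<^sub>R x) = r *\<^sub>R h x) \<and> (\<forall>x. norm (h x) = norm x)"

text \<open>The scalar field is the field of real or of complex numbers; a type class lets
  one statement cover both.\<close>

class real_or_complex = real_normed_field +
  assumes real_or_complex:
    "(\<exists>h :: 'a \<Rightarrow> real. isometric_field_iso h) \<or> (\<exists>h :: 'a \<Rightarrow> complex. isometric_field_iso h)"

instance real :: real_or_complex
  by standard (auto simp: isometric_field_iso_def intro!: exI[of _ id] disjI1)

instance complex :: real_or_complex
  by standard (auto simp: isometric_field_iso_def intro!: exI[of _ id] disjI2)

text \<open>The classes of HOL-Analysis only provide real scalars. A Banach space over \<open>'k\<close> is a type of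
  class \<open>banach\<close> together with a scalar multiplication by \<open>'k\<close> that extends the real one and for
  which the given norm is homogeneous.\<close>

locale normed_space_over = vector_space scale
  for scale :: "'k::real_or_complex \<Rightarrow> 'e::real_normed_vector \<Rightarrow> 'e" +
  assumes scale_of_real: "scale (of_real r) x = r *\<^sub>R x"
    and norm_scale: "norm (scale c x) = norm c * norm x"

definition continuous_operators ::
    "('k \<Rightarrow> 'e \<Rightarrow> 'e) \<Rightarrow> ('k \<Rightarrow> 'f \<Rightarrow> 'f) \<Rightarrow> ('e::real_normed_vector \<Rightarrow>\<^sub>L 'f::real_normed_vector) set"
  where "continuous_operators sE sF =
    {T. \<forall>c x. blinfun_apply T (sE c x) = sF c (blinfun_apply T x)}"

definition dual_space ::
    "('k::real_normed_field \<Rightarrow> 'e \<Rightarrow> 'e) \<Rightarrow> ('e::real_normed_vector \<Rightarrow>\<^sub>L 'k) set"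
  where "dual_space sE = continuous_operators sE (*)"

definition independently_convergent ::
    "(nat \<Rightarrow> 'e::real_normed_vector \<Rightarrow>\<^sub>L 'f::real_normed_vector) \<Rightarrow> bool"
  where "independently_convergent T \<longleftrightarrow>
    (\<forall>x. bounded (range x) \<longrightarrow> summable (\<lambda>n. blinfun_apply (T n) (x n)))"

definition i_measure ::
    "('k \<Rightarrow> 'e \<Rightarrow> 'e) \<Rightarrow> ('k \<Rightarrow> 'f \<Rightarrow> 'f) \<Rightarrow> 'z set set \<Rightarrow>
     ('z set \<Rightarrow> 'e::real_normed_vector \<Rightarrow>\<^sub>L 'f::real_normed_vector) \<Rightarrow> bool"
  where "i_measure sE sF \<MM> \<mu> \<longleftrightarrow>
    (\<forall>A\<in>\<MM>. \<mu> A \<in> continuous_operators sE sF) \<and>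
    (\<forall>A :: nat \<Rightarrow> 'z set. range A \<subseteq> \<MM> \<and> disjoint_family A \<longrightarrow>
      (\<forall>x. (\<lambda>n. blinfun_apply (\<mu> (A n)) x) sums blinfun_apply (\<mu> (\<Union>n. A n)) x) \<and>
      independently_convergent (\<lambda>n. \<mu> (A n)))"

text \<open>Functions on \<open>Z\<close> are represented by total functions; their values outside \<open>Z\<close> never matter.\<close>

definition bounded_functions :: "'z set \<Rightarrow> ('z \<Rightarrow> 'e::real_normed_vector) set"
  where "bounded_functions Z = {f. bounded (f ` Z)}"

text \<open>Inserting 0 only serves to give the norm 0 when \<open>Z\<close> is empty.\<close>

definition sup_norm :: "'z set \<Rightarrow> ('z \<Rightarrow> 'e::real_normed_vector) \<Rightarrow> real"
  where "sup_norm Z f = Sup (insert 0 ((\<lambda>z. norm (f z)) ` Z))"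

definition measurable_functions ::
    "('k::real_normed_field \<Rightarrow> 'e \<Rightarrow> 'e) \<Rightarrow> 'z set \<Rightarrow> 'z set set \<Rightarrow>
     ('z \<Rightarrow> 'e::real_normed_vector) set"
  where "measurable_functions sE Z \<MM> =
    {f \<in> bounded_functions Z. separable_space (top_of_set (f ` Z)) \<and>
      (\<forall>\<psi>\<in>dual_space sE. (\<lambda>z. blinfun_apply \<psi> (f z)) \<in> borel_measurable (sigma Z \<MM>))}"

definition simple_functions ::
    "'z set \<Rightarrow> 'z set set \<Rightarrow> ('z \<Rightarrow> 'e::real_normed_vector) set"
  where "simple_functions Z \<MM> =
    {f \<in> bounded_functions Z. countable (f ` Z) \<and> (\<forall>e. f -` {e} \<inter> Z \<in> \<MM>)}"

definition simple_integral ::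
    "'z set \<Rightarrow> ('z set \<Rightarrow> 'e::real_normed_vector \<Rightarrow>\<^sub>L 'f::real_normed_vector) \<Rightarrow>
     ('z \<Rightarrow> 'e) \<Rightarrow> 'f"
  where "simple_integral Z \<mu> f = (\<Sum>\<^sub>\<infinity>e\<in>UNIV. blinfun_apply (\<mu> (f -` {e} \<inter> Z)) e)"

definition sup_norm_continuous_on ::
    "'z set \<Rightarrow> ('z \<Rightarrow> 'e::real_normed_vector) set \<Rightarrow> (('z \<Rightarrow> 'e) \<Rightarrow> 'f::real_normed_vector) \<Rightarrow> bool"
  where "sup_norm_continuous_on Z S I \<longleftrightarrow>
    (\<forall>f\<in>S. \<forall>\<epsilon>>0. \<exists>\<delta>>0. \<forall>g\<in>S. sup_norm Z (\<lambda>z. g z - f z) < \<delta> \<longrightarrow> norm (I g - I f) < \<epsilon>)"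

text \<open>The unique continuous extension of the simple integral to \<open>measurable_functions\<close>; being
  \<open>extensional\<close> fixes its values elsewhere, so that it is unique as a total function.\<close>

definition i_integral ::
    "('k::real_normed_field \<Rightarrow> 'e \<Rightarrow> 'e) \<Rightarrow> 'z set \<Rightarrow> 'z set set \<Rightarrow>
     ('z set \<Rightarrow> 'e::real_normed_vector \<Rightarrow>\<^sub>L 'f::real_normed_vector) \<Rightarrow> ('z \<Rightarrow> 'e) \<Rightarrow> 'f"
  where "i_integral sE Z \<MM> \<mu> = (THE I.
    I \<in> extensional (measurable_functions sE Z \<MM>) \<and>
    sup_norm_continuous_on Z (measurable_functions sE Z \<MM>) I \<and>
    (\<forall>f\<in>simple_functions Z \<MM>. I f = simple_integral Z \<mu> f))"

end

theory Submission
  imports Defs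
begin

text \<open>The semivariation of an i-measure is finite and tends to 0 along every decreasing sequence of
  sets with empty intersection: otherwise one finds a gliding hump, that is, infinitely many disjoint
  sets each of which carries a finite sum \<open>\<Sum> \<mu>(A\<^sub>i) x\<^sub>i\<close> with \<open>norm x\<^sub>i \<le> 1\<close> of norm at least some
  \<open>c > 0\<close>, contradicting independent convergence. By the Pettis argument, functions with countably
  many values are uniformly dense in \<open>M\<close>, so the integral is Lipschitz with constant the total
  semivariation. For convergence, choose \<open>s\<^sub>n\<close> uniformly close to \<open>f\<^sub>n\<close> and \<open>t\<close> uniformly close
  to the limit \<open>g\<close>; the sets where \<open>s\<^sub>k\<close> is far from \<open>t\<close> for some \<open>k \<ge> n\<close> decrease to the
  empty set, so they eventually have small semivariation.\<close>

section \<open>The Hahn-Banach theorem and norming functionals\<close>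

text \<open>Semivariation is only subadditive, so its continuity from above is no consequence of
  additivity. It comes from the freedom to vary the vectors in independent convergence: setting them
  to 0 outside selected blocks keeps them bounded, and this upgrades convergence of the ordered
  series to a Cauchy criterion for arbitrary finite index sets. The contradictions then share one
  pattern: a bad set contains a bad subset whose removal cuts off a hump, and iteration gives a
  decreasing sequence with humps on its successive differences. In the proof of finiteness the bad
  subset may be a piece of the hump itself and must be given up; its loss has to be bounded in
  advance, which is why the norm boundedness of \<open>\<mu>\<close> comes first. Hahn-Banach serves
  the measurability of preimages of balls. Since measurability is tested only against functionals
  linear over the scalar field, a real norming functional has to be complexified. The integral is
  given by a definite description. Before it can be estimated, existence (from the estimate on
  simple functions) and uniqueness (from density) must be established.\<close>

definition sublinear :: "('a::real_vector \<Rightarrow> real) \<Rightarrow> bool" where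
  "sublinear p \<longleftrightarrow> (\<forall>x y. p (x + y) \<le> p x + p y) \<and> (\<forall>r x. r \<ge> 0 \<longrightarrow> p (r *\<^sub>R x) = r * p x)"

text \<open>Applying the upper bound to \<open>inverse r\<close> and \<open>r *\<^sub>R x\<close>
  gives the reverse inequality for r > 0; at r = 0 subadditivity yields
  \<open>p 0 \<ge> 0\<close>.\<close>

lemma sublinearI:
  assumes "\<And>x y. p (x + y) \<le> p x + p y" and *: "\<And>r x. r \<ge> 0 \<Longrightarrow> p (r *\<^sub>R x) \<le> r * p x"
  shows "sublinear p"
  unfolding sublinear_def
proof (intro conjI allI impI antisym assms)
  fix r :: real and x assume r: "r \<ge> 0"
  show "r * p x \<le> p (r *\<^sub>R x)"
  proof (cases "r = 0")
    case True
    then show ?thesis using assms(1)[of 0 0] by simp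
  next
    case False
    then show ?thesis using *[of "inverse r" "r *\<^sub>R x"] r by (simp add: field_simps)
  qed
qed

lemma sublinear_add: "sublinear p \<Longrightarrow> p (x + y) \<le> p x + p y"
  and sublinear_scaleR: "sublinear p \<Longrightarrow> r \<ge> 0 \<Longrightarrow> p (r *\<^sub>R x) = r * p x"
  by (auto simp: sublinear_def)

lemma sublinear_0: "sublinear p \<Longrightarrow> p 0 = 0"
  using sublinear_scaleR[of p 0 0] by simp

lemma sublinear_minus: "sublinear p \<Longrightarrow> - p (- x) \<le> p x"
  using sublinear_add[of p x "- x"] sublinear_0[of p] by simp

text \<open>For sublinear \<open>p\<close> this is the greatest sublinear functional below
  \<open>p\<close> whose value at \<open>- v\<close> is at most \<open>- p v\<close>, that is, the
  largest one that is already odd along \<open>v\<close> with value \<open>p v\<close>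
  there.\<close>

definition shrink :: "('a::real_vector \<Rightarrow> real) \<Rightarrow> 'a \<Rightarrow> 'a \<Rightarrow> real" where
  "shrink p v x = (INF t\<in>{0..}. p (x + t *\<^sub>R v) - t * p v)"

context
  fixes p :: "'a::real_vector \<Rightarrow> real" and v :: 'a
  assumes p: "sublinear p"
begin

lemma shrink_le: "t \<ge> 0 \<Longrightarrow> shrink p v x \<le> p (x + t *\<^sub>R v) - t * p v"
  unfolding shrink_def
proof (rule cINF_lower)
  show "bdd_below ((\<lambda>t. p (x + t *\<^sub>R v) - t * p v) ` {0..})"
  proof (rule bdd_belowI2[of _ "- p (- x)"])
    fix t :: real assume "t \<in> {0..}"
    then show "- p (- x) \<le> p (x + t *\<^sub>R v) - t * p v"
      using sublinear_add[OF p, of "x + t *\<^sub>R v" "- x"] sublinear_scaleR[OF p, of t v] by simp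
  qed
qed simp

lemma shrink_greatest: "(\<And>t. t \<ge> 0 \<Longrightarrow> c \<le> p (x + t *\<^sub>R v) - t * p v) \<Longrightarrow> c \<le> shrink p v x"
  unfolding shrink_def by (rule cINF_greatest) auto

lemma shrink_le_self: "shrink p v \<le> p"
  using shrink_le[of 0] by (simp add: le_fun_def)

lemma shrink_minus: "shrink p v (- v) \<le> - p v"
  using shrink_le[of 1 "- v"] sublinear_0[OF p] by simp

text \<open>For subadditivity the two infima are taken one at a time, parameters \<open>s\<close>
  and \<open>t\<close> merging into \<open>s + t\<close>; for homogeneity the parameter is rescaled
  to \<open>r * t\<close>.\<close>

lemma sublinear_shrink: "sublinear (shrink p v)"
proof (rule sublinearI)
  fix x y
  have "shrink p v (x + y) - shrink p v y \<le> shrink p v x"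
  proof (rule shrink_greatest)
    fix s :: real assume s: "s \<ge> 0"
    have "shrink p v (x + y) - (p (x + s *\<^sub>R v) - s * p v) \<le> shrink p v y"
    proof (rule shrink_greatest)
      fix t :: real assume t: "t \<ge> 0"
      have "(x + s *\<^sub>R v) + (y + t *\<^sub>R v) = (x + y) + (s + t) *\<^sub>R v"
        by (simp add: algebra_simps)
      then have "p ((x + y) + (s + t) *\<^sub>R v) \<le> p (x + s *\<^sub>R v) + p (y + t *\<^sub>R v)"
        using sublinear_add[OF p] by metis
      with shrink_le[of "s + t" "x + y"] s t
      show "shrink p v (x + y) - (p (x + s *\<^sub>R v) - s * p v) \<le> p (y + t *\<^sub>R v) - t * p v"
        by (simp add: algebra_simps)
    qed
    then show "shrink p v (x + y) - shrink p v y \<le> p (x + s *\<^sub>R v) - s * p v"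
      by simp
  qed
  then show "shrink p v (x + y) \<le> shrink p v x + shrink p v y" by simp
next
  fix r :: real and x assume r: "r \<ge> 0"
  show "shrink p v (r *\<^sub>R x) \<le> r * shrink p v x"
  proof (cases "r = 0")
    case True
    then show ?thesis using shrink_le[of 0 0] sublinear_0[OF p] by simp
  next
    case False
    have "shrink p v (r *\<^sub>R x) / r \<le> shrink p v x"
    proof (rule shrink_greatest)
      fix t :: real assume t: "t \<ge> 0"
      have "shrink p v (r *\<^sub>R x) \<le> p (r *\<^sub>R (x + t *\<^sub>R v)) - (r * t) * p v"
        using shrink_le[of "r * t" "r *\<^sub>R x"] r t by (simp add: scaleR_add_right)
      then show "shrink p v (r *\<^sub>R x) / r \<le> p (x + t *\<^sub>R v) - t * p v"
        using r False by (simp only: sublinear_scaleR[OF p r]) (simp add: field_simps)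
    qed
    then show ?thesis using r False by (simp add: field_simps)
  qed
qed

end

text \<open>A pointwise minimal sublinear functional \<open>q\<close> satisfies \<open>shrink q v = q\<close> for all \<open>v\<close>, which
  makes it odd and hence linear; so Zorn's lemma can be used on total functionals.\<close>

lemma sublinear_dominates_linear:
  assumes p: "sublinear p"
  obtains q where "linear q" "q \<le> p"
proof -
  define A where "A = {q. sublinear q \<and> q \<le> p}"
  have "\<exists>m\<in>A. \<forall>a\<in>A. a \<le> m \<longrightarrow> a = m"
  proof (rule predicate_Zorn)
    \<comment> \<open>The order is reversed, so the maximal element that Zorn's lemma delivers is a
      minimal sublinear functional.\<close>
    show "partial_order_on A (relation_of (\<lambda>a b. b \<le> a) A)"
      by (rule partial_order_on_relation_ofI) auto
    fix C assume C: "C \<in> Chains (relation_of (\<lambda>a b. b \<le> a) A)"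
    then have CA: "C \<subseteq> A" and tot: "\<And>a b. a \<in> C \<Longrightarrow> b \<in> C \<Longrightarrow> a \<le> b \<or> b \<le> a"
      by (auto simp: Chains_def relation_of_def)
    show "\<exists>u\<in>A. \<forall>a\<in>C. u \<le> a"
    proof (cases "C = {}")
      case True
      then show ?thesis using p by (auto simp: A_def)
    next
      case False
      define u where "u x = (INF q\<in>C. q x)" for x
      \<comment> \<open>Every \<open>q\<close> of the chain satisfies
        \<open>q x \<ge> - q (- x) \<ge> - p (- x)\<close>, so the pointwise infimum is
        finite.\<close>
      have bdd: "bdd_below ((\<lambda>q. q x) ` C)" for x
      proof (rule bdd_belowI2[of _ "- p (- x)"])
        fix q assume "q \<in> C"
        then have "sublinear q" "q (- x) \<le> p (- x)"
          using CA by (auto simp: A_def le_fun_def)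
        then show "- p (- x) \<le> q x"
          using sublinear_minus[of q x] by linarith
      qed
      have u_le: "u x \<le> q x" if "q \<in> C" for q x
        unfolding u_def by (rule cINF_lower[OF bdd that])
      have u_ge: "c \<le> u x" if "\<And>q. q \<in> C \<Longrightarrow> c \<le> q x" for c x
        unfolding u_def by (rule cINF_greatest[OF False that])
      have "sublinear u"
      proof (rule sublinearI)
        fix x y
        \<comment> \<open>An infimum of sublinear functionals is not subadditive in general; in a
          chain the smaller of \<open>a\<close> and \<open>b\<close> serves for both
          summands.\<close>
        have "u (x + y) \<le> a x + b y" if ab: "a \<in> C" "b \<in> C" for a b
        proof -
          obtain m where m: "m \<in> C" "m \<le> a" "m \<le> b"
            using tot[OF ab] ab by blast
          have "u (x + y) \<le> m (x + y)" by (rule u_le[OF m(1)])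
          also have "\<dots> \<le> m x + m y"
            using m(1) CA by (auto simp: A_def intro!: sublinear_add)
          also have "\<dots> \<le> a x + b y"
            using m by (auto simp: le_fun_def intro!: add_mono)
          finally show ?thesis .
        qed
        then have "u (x + y) - a x \<le> u y" if "a \<in> C" for a
          using that by (intro u_ge) (simp add: diff_le_eq add.commute[of _ "a x"])
        then have "u (x + y) - u y \<le> u x"
          by (intro u_ge) (simp add: algebra_simps)
        then show "u (x + y) \<le> u x + u y" by simp
      next
        fix r :: real and x assume r: "r \<ge> 0"
        have *: "u (r *\<^sub>R x) \<le> r * q x" if "q \<in> C" for q
          using u_le[OF that, of "r *\<^sub>R x"] that CA r sublinear_scaleR[of q r x] by (auto simp: A_def)
        show "u (r *\<^sub>R x) \<le> r * u x"
        proof (cases "r = 0")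
          case True
          then show ?thesis using * False by auto
        next
          case r0: False
          have "u (r *\<^sub>R x) / r \<le> u x"
            using * r r0 by (intro u_ge) (simp add: field_simps)
          then show ?thesis using r r0 by (simp add: field_simps)
        qed
      qed
      moreover obtain q where "q \<in> C" using False by blast
      then have "u \<le> p"
        using u_le[of q] CA by (force simp: A_def le_fun_def intro: order_trans)
      ultimately show ?thesis
        using u_le by (auto simp: A_def le_fun_def intro!: bexI[of _ u])
    qed
  qed
  then obtain q where q: "sublinear q" "q \<le> p" and min: "\<And>a. sublinear a \<Longrightarrow> a \<le> q \<Longrightarrow> a = q"
    unfolding A_def by (auto intro: order_trans)
  have "shrink q v = q" for v
    using q by (intro min sublinear_shrink shrink_le_self)
  then have neg: "q (- v) = - q v" for v
    using shrink_minus[OF q(1), of v] sublinear_minus[OF q(1), of "- v"] by simp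
  have "linear q"
  proof (rule linearI)
    fix x y
    \<comment> \<open>Oddness turns subadditivity at the negatives into superadditivity.\<close>
    have "q (- x + - y) \<le> q (- x) + q (- y)"
      using q(1) by (rule sublinear_add)
    then have "q x + q y \<le> q (x + y)"
      using neg[of "x + y"] by (simp add: neg)
    then show "q (x + y) = q x + q y"
      using sublinear_add[OF q(1), of x y] by simp
  next
    fix r :: real and x
    show "q (r *\<^sub>R x) = r *\<^sub>R q x"
    proof (cases "r \<ge> 0")
      case True
      then show ?thesis using sublinear_scaleR[OF q(1)] by simp
    next
      case False
      then have "q (- (r *\<^sub>R x)) = - r * q x"
        using sublinear_scaleR[OF q(1), of "- r" x] by simp
      then show ?thesis using neg by simp
    qed
  qed
  with q(2) that show ?thesis by blast
qed

text \<open>Dominating by \<open>shrink norm v\<close> instead of \<open>norm\<close> fixes the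
  value at \<open>v\<close>: a linear \<open>u\<close> below it has
  \<open>u (- v) \<le> - norm v\<close>, hence \<open>u v \<ge> norm v\<close>.\<close>

lemma real_norming_functional:
  fixes v :: "'a::real_normed_vector"
  obtains u where "linear u" "\<And>x. u x \<le> norm x" "u v = norm v"
proof -
  have n: "sublinear (norm :: 'a \<Rightarrow> real)"
    by (rule sublinearI) (auto intro: norm_triangle_ineq)
  obtain u where u: "linear u" "u \<le> shrink norm v"
    using sublinear_dominates_linear[OF sublinear_shrink[OF n]] by blast
  then have le: "u x \<le> norm x" for x
    using shrink_le_self[OF n, of v] by (auto simp: le_fun_def intro: order_trans)
  have "u (- v) \<le> - norm v"
    using u(2) shrink_minus[OF n, of v] by (auto simp: le_fun_def intro: order_trans)
  with u(1) le[of v] have "u v = norm v"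
    by (simp add: linear_neg)
  with u le that show ?thesis by blast
qed

text \<open>Multiplicativity makes \<open>h 1\<close> idempotent and isometry makes it nonzero, so
  it is 1; real homogeneity does the rest.\<close>

lemma isometric_field_iso_of_real:
  assumes "isometric_field_iso (h :: 'k::real_normed_field \<Rightarrow> 'l::real_normed_field)"
  shows "h (of_real r) = of_real r"
proof -
  have "h 1 * h 1 = h 1 * 1" "norm (h 1) = 1"
    using assms unfolding isometric_field_iso_def by (metis mult.right_neutral, simp)
  then have "h 1 = 1"
    by (metis mult_cancel_left norm_zero zero_neq_one)
  then show ?thesis
    using assms unfolding isometric_field_iso_def by (simp add: of_real_def)
qed

lemma dual_spaceI:
  fixes sE :: "'k::real_or_complex \<Rightarrow> 'e::real_normed_vector \<Rightarrow> 'e"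
  assumes E: "normed_space_over sE" and add: "\<And>x y. \<psi> (x + y) = \<psi> x + \<psi> y"
    and scale: "\<And>c x. \<psi> (sE c x) = c * \<psi> x" and le: "\<And>x. norm (\<psi> x) \<le> norm x"
  shows "Blinfun \<psi> \<in> dual_space sE" "blinfun_apply (Blinfun \<psi>) = \<psi>"
proof -
  interpret normed_space_over sE by fact
  have "bounded_linear \<psi>"
  proof (rule bounded_linear_intro[of _ 1])
    show "\<psi> (r *\<^sub>R x) = r *\<^sub>R \<psi> x" for r x
      using scale[of "of_real r" x] by (simp add: scale_of_real scaleR_conv_of_real)
  qed (use add le in auto)
  then show *: "blinfun_apply (Blinfun \<psi>) = \<psi>"
    by (rule bounded_linear_Blinfun_apply)
  show "Blinfun \<psi> \<in> dual_space sE"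
    unfolding dual_space_def continuous_operators_def using scale by (simp add: *)
qed

text \<open>Over the reals, \<open>u\<close> itself works after transport along the field
  isomorphism. Over the complex numbers this is the Bohnenblust-Sobczyk construction: a complex
  functional is recovered from its real part \<open>u\<close> as u(x) - i u(i x).\<close>

lemma norming_functional:
  fixes sE :: "'k::real_or_complex \<Rightarrow> 'e::real_normed_vector \<Rightarrow> 'e"
  assumes E: "normed_space_over sE"
  obtains \<psi> where "\<psi> \<in> dual_space sE" "\<And>x. norm (blinfun_apply \<psi> x) \<le> norm x"
    "norm (blinfun_apply \<psi> v) \<ge> norm v"
proof -
  interpret normed_space_over sE by fact
  obtain u where u: "linear u" and u_le: "\<And>x. u x \<le> norm x" and uv: "u v = norm v"
    using real_norming_functional[of v] by metis
  note u_simps = linear_add[OF u] linear_scale[OF u] linear_diff[OF u] linear_neg[OF u]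
  have abs_u: "\<bar>u x\<bar> \<le> norm x" for x
    using u_le[of x] u_le[of "- x"] by (simp add: u_simps)
  have "\<exists>\<psi>. (\<forall>x y. \<psi> (x + y) = \<psi> x + \<psi> y) \<and> (\<forall>c x. \<psi> (sE c x) = c * \<psi> x) \<and>
      (\<forall>x. norm (\<psi> x) \<le> norm x) \<and> norm v \<le> norm (\<psi> v)"
    using real_or_complex[where 'a='k]
  proof
    assume "\<exists>h :: 'k \<Rightarrow> real. isometric_field_iso h"
    then obtain h :: "'k \<Rightarrow> real" where h: "isometric_field_iso h" ..
    have c: "c = of_real (h c)" for c
    proof -
      have "h (of_real (h c)) = h c"
        using isometric_field_iso_of_real[OF h] by simp
      then show ?thesis
        using h unfolding isometric_field_iso_def bij_def inj_def by metis
    qed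
    have "of_real (u (sE c x)) = c * of_real (u x)" for c x
      by (subst (1 2) c) (simp add: scale_of_real u_simps)
    then show ?thesis
      using abs_u uv by (intro exI[of _ "\<lambda>x. of_real (u x)"]) (simp add: u_simps)
  next
    assume "\<exists>h :: 'k \<Rightarrow> complex. isometric_field_iso h"
    then obtain h :: "'k \<Rightarrow> complex" where h: "isometric_field_iso h" ..
    then have h_add: "h (x + y) = h x + h y" and h_mult: "h (x * y) = h x * h y"
      and h_norm: "norm (h x) = norm x" and "bij h" for x y
      by (auto simp: isometric_field_iso_def)
    have h_diff: "h (x - y) = h x - h y" for x y
      using h_add[of "x - y" y] by simp
    note h_of_real = isometric_field_iso_of_real[OF h]
    define k where "k = inv h"
    have hk [simp]: "h (k z) = z" and kh [simp]: "k (h c) = c" for z c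
      using \<open>bij h\<close> by (auto simp: k_def bij_def surj_f_inv_f)
    have h_eqI: "h x = h y \<Longrightarrow> x = y" for x y by (metis kh)
    have k_add: "k (z + w) = k z + k w" and k_mult: "k (z * w) = k z * k w"
      and k_norm: "norm (k z) = norm z" for z w
      using h_norm[of "k z"] by (auto intro!: h_eqI simp: h_add h_mult)
    \<comment> \<open>The imaginary unit of the abstract scalar field; real scalars together with
      \<open>j\<close> express every \<open>c\<close>.\<close>
    define j where "j = k \<i>"
    define w where "w x = Complex (u x) (- u (sE j x))" for x
    have w_scale: "w (sE c x) = h c * w x" for c x
    proof -
      define a b where "a = Re (h c)" and "b = Im (h c)"
      have c: "c = of_real a + of_real b * j"
        by (rule h_eqI) (simp add: h_add h_mult h_of_real j_def a_def b_def complex_eq mult.commute)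
      have jc: "j * c = of_real a * j + of_real (- b)"
        by (rule h_eqI) (simp add: c h_add h_diff h_mult h_of_real j_def complex_eq_iff)
      have "u (sE c x) = a * u x + b * u (sE j x)"
        unfolding c by (simp only: scale_left_distrib scale_scale[symmetric] scale_of_real u_simps) simp
      moreover have "sE j (sE c x) = a *\<^sub>R sE j x + (- b) *\<^sub>R x"
        unfolding scale_scale jc by (simp only: scale_left_distrib scale_scale[symmetric] scale_of_real)
      then have "u (sE j (sE c x)) = a * u (sE j x) - b * u x"
        by (simp add: u_simps)
      ultimately show ?thesis
        by (simp add: w_def complex_eq_iff a_def b_def algebra_simps)
    qed
    have w_norm: "norm (w x) \<le> norm x" for x
    proof (cases "w x = 0")
      case False
      \<comment> \<open>The unimodular factor that rotates \<open>w x\<close> onto the positive real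
        axis; there \<open>w\<close> agrees with its real part \<open>u\<close>, whose bound is
        known.\<close>
      define r where "r = cnj (w x) / norm (w x)"
      have "norm r = 1" using False by (simp add: r_def norm_divide)
      have "w (sE (k r) x) = of_real (norm (w x))"
        using False complex_norm_square[of "w x"] by (simp add: w_scale r_def power2_eq_square divide_eq_eq mult.commute)
      then have "norm (w x) = u (sE (k r) x)"
        by (metis Re_complex_of_real complex.sel(1) w_def)
      also have "\<dots> \<le> norm (sE (k r) x)" by (rule u_le)
      also have "\<dots> = norm x" using \<open>norm r = 1\<close> by (simp add: norm_scale k_norm)
      finally show ?thesis .
    qed simp
    have "norm v \<le> norm (w v)"
      using abs_Re_le_cmod[of "w v"] uv by (simp add: w_def)
    moreover have "w (x + y) = w x + w y" for x y
      by (simp add: w_def scale_right_distrib u_simps complex_eq_iff)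
    ultimately show ?thesis
      using w_norm by (intro exI[of _ "\<lambda>x. k (w x)"]) (simp add: k_add k_mult k_norm w_scale)
  qed
  then obtain \<psi> where "\<And>x y. \<psi> (x + y) = \<psi> x + \<psi> y" "\<And>c x. \<psi> (sE c x) = c * \<psi> x"
      "\<And>x. norm (\<psi> x) \<le> norm x" "norm v \<le> norm (\<psi> v)"
    by blast
  then show ?thesis
    using that[of "Blinfun \<psi>"] dual_spaceI[OF E, of \<psi>] by simp
qed

section \<open>Weakly measurable functions with separable range\<close>

text \<open>The dense set is allowed to lie outside \<open>S\<close>, a form that passes easily to
  limits. To move it into \<open>S\<close>, choose one point of \<open>S\<close> in each ball that
  has centre in \<open>C\<close> and radius 1/(n+1) and meets \<open>S\<close>.\<close>

lemma separable_space_iff_countable_closure: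
  fixes S :: "'a::metric_space set"
  shows "separable_space (top_of_set S) \<longleftrightarrow> (\<exists>C. countable C \<and> S \<subseteq> closure C)"
proof
  assume "separable_space (top_of_set S)"
  then show "\<exists>C. countable C \<and> S \<subseteq> closure C"
    unfolding separable_space_def by (auto simp: closure_of_subtopology)
next
  assume "\<exists>C. countable C \<and> S \<subseteq> closure C"
  then obtain C where C: "countable C" "S \<subseteq> closure C" by blast
  define P where "P = {p \<in> C \<times> (UNIV :: nat set). ball (fst p) (inverse (Suc (snd p))) \<inter> S \<noteq> {}}"
  have "\<forall>p\<in>P. \<exists>s. s \<in> ball (fst p) (inverse (Suc (snd p))) \<inter> S"
    by (auto simp: P_def)
  then obtain s where s: "\<And>p. p \<in> P \<Longrightarrow> s p \<in> ball (fst p) (inverse (Suc (snd p))) \<inter> S"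
    by metis
  have "x \<in> closure (s ` P)" if "x \<in> S" for x
    unfolding closure_approachable
  proof (intro allI impI)
    fix e :: real assume "e > 0"
    then obtain n where n: "inverse (Suc n) < e / 2"
      using reals_Archimedean[of "e / 2"] by auto
    obtain c where c: "c \<in> C" "dist c x < inverse (Suc n)"
      using subsetD[OF C(2) \<open>x \<in> S\<close>, unfolded closure_approachable, rule_format, of "inverse (Suc n)"]
      by auto
    then have "(c, n) \<in> P" using that by (auto simp: P_def)
    with s[of "(c, n)"] c n have "dist (s (c, n)) x < e"
      using dist_triangle3[of "s (c, n)" x c] by auto
    with \<open>(c, n) \<in> P\<close> show "\<exists>y\<in>s ` P. dist y x < e" by blast
  qed
  moreover have "s ` P \<subseteq> S" using s by blast
  moreover have "countable P"
    unfolding P_def by (rule countable_subset[of _ "C \<times> (UNIV :: nat set)"]) (use C in auto)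
  ultimately have "countable (s ` P)" "s ` P \<subseteq> S" "S \<inter> closure (s ` P) = S"
    by auto
  then show "separable_space (top_of_set S)"
    unfolding separable_space_def
    by (intro exI[of _ "s ` P"]) (simp add: closure_of_subtopology Int_absorb1)
qed

lemma simple_functions_subset_measurable_functions:
  fixes sE :: "'k::real_normed_field \<Rightarrow> 'e::real_normed_vector \<Rightarrow> 'e" and Z :: "'z set"
  assumes "sigma_algebra Z \<MM>"
  shows "simple_functions Z \<MM> \<subseteq> measurable_functions sE Z \<MM>"
proof
  interpret sigma_algebra Z \<MM> by fact
  fix s :: "'z \<Rightarrow> 'e" assume "s \<in> simple_functions Z \<MM>"
  then have s: "s \<in> bounded_functions Z" "countable (s ` Z)" and lev: "\<And>e. s -` {e} \<inter> Z \<in> \<MM>"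
    by (auto simp: simple_functions_def)
  have "(\<lambda>z. blinfun_apply \<psi> (s z)) \<in> borel_measurable (sigma Z \<MM>)" for \<psi> :: "'e \<Rightarrow>\<^sub>L 'k"
  proof (rule measurableI)
    fix A
    have "(\<lambda>z. blinfun_apply \<psi> (s z)) -` A \<inter> Z = (\<Union>e\<in>{e \<in> s ` Z. \<psi> e \<in> A}. s -` {e} \<inter> Z)"
      by auto
    also have "\<dots> \<in> \<MM>"
      using s(2) lev by (intro countable_UN'') (auto intro: countable_subset)
    finally show "(\<lambda>z. blinfun_apply \<psi> (s z)) -` A \<inter> space (sigma Z \<MM>) \<in> sets (sigma Z \<MM>)"
      by (simp add: space_measure_of_conv sets_measure_of_eq)
  qed simp
  moreover have "separable_space (top_of_set (s ` Z))"
    unfolding separable_space_iff_countable_closure using s(2) closure_subset[of "s ` Z"] by (intro exI[of _ "s ` Z"]) simp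
  ultimately show "s \<in> measurable_functions sE Z \<MM>"
    using s(1) by (auto simp: measurable_functions_def)
qed

text \<open>Pettis: the norm on a separable set is the supremum of countably many functionals, so that
  weak measurability makes the preimages of balls measurable.\<close>

lemma measurable_functions_cball:
  fixes sE :: "'k::real_or_complex \<Rightarrow> 'e::real_normed_vector \<Rightarrow> 'e"
  assumes E: "normed_space_over sE" and "sigma_algebra Z \<MM>"
    and f: "f \<in> measurable_functions sE Z \<MM>"
  shows "{z \<in> Z. norm (f z - c) \<le> r} \<in> \<MM>"
proof -
  interpret sigma_algebra Z \<MM> by fact
  obtain D where D: "countable D" "f ` Z \<subseteq> closure D"
    using f unfolding measurable_functions_def separable_space_iff_countable_closure by blast
  have "\<exists>\<psi>. \<psi> \<in> dual_space sE \<and> (\<forall>x. norm (blinfun_apply \<psi> x) \<le> norm x) \<and>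
      norm (blinfun_apply \<psi> (d - c)) \<ge> norm (d - c)" for d
    by (rule norming_functional[OF E, of "d - c"]) blast
  then obtain \<psi> where \<psi>: "\<And>d. \<psi> d \<in> dual_space sE" "\<And>d x. norm (blinfun_apply (\<psi> d) x) \<le> norm x"
      "\<And>d. norm (blinfun_apply (\<psi> d) (d - c)) \<ge> norm (d - c)"
    by metis
  have "norm (f z - c) \<le> r"
    if z: "z \<in> Z" and le: "\<And>d. d \<in> D \<Longrightarrow> norm (blinfun_apply (\<psi> d) (f z - c)) \<le> r" for z
  proof (rule field_le_epsilon)
    fix e :: real assume "e > 0"
    moreover have "f z \<in> closure D" using D(2) z by blast
    ultimately obtain d where d: "d \<in> D" "norm (d - f z) < e / 2"
      unfolding closure_approachable dist_norm by (meson half_gt_zero)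
    \<comment> \<open>The functional is attached to \<open>d\<close> and norms \<open>d - c\<close>,
      not \<open>f z - c\<close>; passing from \<open>f z\<close> to \<open>d\<close> and back costs
      \<open>norm (d - f z)\<close> twice, hence the choice of e/2.\<close>
    have "norm (f z - c) \<le> norm (d - c) + norm (d - f z)"
      using norm_triangle_ineq4[of "d - c" "d - f z"] by simp
    also have "norm (d - c) \<le> norm (blinfun_apply (\<psi> d) (f z - c) + blinfun_apply (\<psi> d) (d - f z))"
      using \<psi>(3)[of d] by (simp add: blinfun.bilinear_simps)
    also have "\<dots> \<le> r + norm (d - f z)"
      using le[OF d(1)] \<psi>(2)[of d "d - f z"] by (rule norm_triangle_le[OF add_mono])
    finally show "norm (f z - c) \<le> r + e" using d(2) by simp
  qed
  then have "{z \<in> Z. norm (f z - c) \<le> r} = (\<Inter>d\<in>D. {z \<in> Z. norm (blinfun_apply (\<psi> d) (f z - c)) \<le> r}) \<inter> Z"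
    by (auto intro: order_trans[OF \<psi>(2)])
  also have "\<dots> = Z - (\<Union>d\<in>D. Z - {z \<in> Z. norm (blinfun_apply (\<psi> d) (f z - c)) \<le> r})"
    by auto
  also have "\<dots> \<in> \<MM>"
  proof (intro Diff top countable_UN'' D(1))
    fix d assume "d \<in> D"
    have "(\<lambda>z. blinfun_apply (\<psi> d) (f z)) \<in> borel_measurable (sigma Z \<MM>)"
      using f \<psi>(1) by (auto simp: measurable_functions_def)
    then have "(\<lambda>z. norm (blinfun_apply (\<psi> d) (f z) - blinfun_apply (\<psi> d) c)) \<in> borel_measurable (sigma Z \<MM>)"
      by (rule borel_measurable_continuous_on[rotated]) (intro continuous_intros)
    then have "{z \<in> space (sigma Z \<MM>). norm (blinfun_apply (\<psi> d) (f z) - blinfun_apply (\<psi> d) c) \<le> r}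
        \<in> sets (sigma Z \<MM>)"
      by measurable
    then show "{z \<in> Z. norm (blinfun_apply (\<psi> d) (f z - c)) \<le> r} \<in> \<MM>"
      by (simp add: space_measure_of_conv sets_measure_of_eq blinfun.diff_right)
  qed
  finally show ?thesis .
qed

text \<open>The preimages of the \<open>e\<close>-balls about a countable dense set cover
  \<open>Z\<close> and are measurable. Sending \<open>z\<close> to the centre of the first ball that
  contains \<open>f z\<close> turns the cover into a countable measurable partition.\<close>

lemma simple_functions_dense:
  fixes sE :: "'k::real_or_complex \<Rightarrow> 'e::real_normed_vector \<Rightarrow> 'e"
  assumes E: "normed_space_over sE" and "sigma_algebra Z \<MM>"
    and f: "f \<in> measurable_functions sE Z \<MM>" and e: "e > 0"
  obtains s where "s \<in> simple_functions Z \<MM>" "\<And>z. z \<in> Z \<Longrightarrow> norm (s z - f z) \<le> e"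
proof -
  interpret sigma_algebra Z \<MM> by fact
  obtain D where D: "countable D" "f ` Z \<subseteq> closure D"
    using f unfolding measurable_functions_def separable_space_iff_countable_closure by blast
  show thesis
  proof (cases "D = {}")
    case True
    then have "Z = {}" using D by auto
    then have "(\<lambda>_. 0) \<in> simple_functions Z \<MM>"
      by (auto simp: simple_functions_def bounded_functions_def)
    with \<open>Z = {}\<close> that show ?thesis by blast
  next
    case False
    define c where "c = from_nat_into D"
    have range: "range c = D"
      unfolding c_def using D False by (intro range_from_nat_into)
    define B where "B n = {z \<in> Z. norm (f z - c n) \<le> e}" for n
    define i where "i z = (LEAST n. z \<in> B n)" for z
    have ex: "\<exists>n. z \<in> B n" if "z \<in> Z" for z
    proof -
      have "f z \<in> closure D" using D(2) that by blast
      then obtain d where "d \<in> D" "norm (f z - d) < e"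
        using e by (auto simp: closure_approachable dist_norm norm_minus_commute)
      moreover then obtain n where "d = c n" using range by auto
      ultimately show ?thesis using that by (auto simp: B_def intro!: exI[of _ n])
    qed
    have iB: "z \<in> B (i z)" if "z \<in> Z" for z
      unfolding i_def using ex[OF that] by (rule LeastI_ex)
    have i_eq: "i z = n \<longleftrightarrow> z \<in> disjointed B n" if "z \<in> Z" for z n
    proof -
      have "i z = n" if n: "z \<in> B n" "\<forall>m<n. z \<notin> B m"
        unfolding i_def
      proof (rule Least_equality)
        show "n \<le> m" if "z \<in> B m" for m
          using n(2) that by (meson not_le)
      qed (rule n(1))
      moreover have "z \<notin> B m" if "m < i z" for m
        using that unfolding i_def by (rule not_less_Least)
      moreover have "z \<in> disjointed B n \<longleftrightarrow> z \<in> B n \<and> (\<forall>m<n. z \<notin> B m)"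
        by (auto simp: disjointed_def)
      ultimately show ?thesis
        using iB[OF \<open>z \<in> Z\<close>] by metis
    qed
    have "range B \<subseteq> \<MM>"
      unfolding B_def using measurable_functions_cball[OF E \<open>sigma_algebra Z \<MM>\<close> f] by auto
    then have dB: "disjointed B n \<in> \<MM>" for n
      using range_disjointed_sets by blast
    have close: "norm (c (i z) - f z) \<le> e" if "z \<in> Z" for z
      using iB[OF that] by (simp add: B_def norm_minus_commute)
    have "(\<lambda>z. c (i z)) \<in> simple_functions Z \<MM>"
      unfolding simple_functions_def
    proof (intro CollectI conjI allI)
      obtain K where K: "\<And>z. z \<in> Z \<Longrightarrow> norm (f z) \<le> K"
        using f by (auto simp: measurable_functions_def bounded_functions_def bounded_iff)
      have "norm (c (i z)) \<le> K + e" if "z \<in> Z" for z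
        using K[OF that] close[OF that] norm_triangle_sub[of "c (i z)" "f z"] by linarith
      then show "(\<lambda>z. c (i z)) \<in> bounded_functions Z"
        by (auto simp: bounded_functions_def bounded_iff)
      show "countable ((\<lambda>z. c (i z)) ` Z)"
        using D range by (auto intro: countable_subset[of _ D])
      fix y
      \<comment> \<open>The enumeration \<open>c\<close> repeats values when \<open>D\<close> is
        finite, so one level set may consist of several cells.\<close>
      have "(\<lambda>z. c (i z)) -` {y} \<inter> Z = (\<Union>n\<in>{n. c n = y}. disjointed B n \<inter> Z)"
        by (auto simp: i_eq[symmetric])
      also have "\<dots> \<in> \<MM>"
      proof (rule countable_UN'')
        show "disjointed B n \<inter> Z \<in> \<MM>" for n
          using dB by (intro Int top)
      qed simp
      finally show "(\<lambda>z. c (i z)) -` {y} \<inter> Z \<in> \<MM>" .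
    qed
    with close that show ?thesis by blast
  qed
qed

text \<open>All values of the limit lie in the closure of the union of the countable sets found for
  the \<open>f n\<close>; weak measurability passes to the limit one functional at a time. Thus the
  integral of the limit is meaningful.\<close>

lemma measurable_functions_pointwise_limit:
  fixes sE :: "'k::real_normed_field \<Rightarrow> 'e::real_normed_vector \<Rightarrow> 'e"
  assumes "sigma_algebra Z \<MM>"
    and f: "\<And>n. f n \<in> measurable_functions sE Z \<MM>"
    and C: "\<And>n z. z \<in> Z \<Longrightarrow> norm (f n z) \<le> C"
    and lim: "\<And>z. z \<in> Z \<Longrightarrow> (\<lambda>n. f n z) \<longlonglongrightarrow> g z"
  shows "g \<in> measurable_functions sE Z \<MM>"
  unfolding measurable_functions_def
proof (intro CollectI conjI ballI)
  have "norm (g z) \<le> C" if "z \<in> Z" for z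
    using tendsto_norm[OF lim[OF that]] C[OF that] by (intro LIMSEQ_le_const2) auto
  then show "g \<in> bounded_functions Z"
    by (auto simp: bounded_functions_def bounded_iff)
  have "\<exists>D. countable D \<and> f n ` Z \<subseteq> closure D" for n
    using f[of n] unfolding measurable_functions_def separable_space_iff_countable_closure by blast
  then obtain D where D: "\<And>n. countable (D n)" "\<And>n. f n ` Z \<subseteq> closure (D n)"
    by metis
  have "g z \<in> closure (\<Union>n. D n)" if "z \<in> Z" for z
  proof (rule closed_sequentially[OF closed_closure _ lim[OF that]])
    fix n
    show "f n z \<in> closure (\<Union>n. D n)"
      using D(2)[of n] that closure_mono[of "D n" "\<Union>n. D n"] by blast
  qed
  then show "separable_space (top_of_set (g ` Z))"
    unfolding separable_space_iff_countable_closure using D(1)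
    by (intro exI[of _ "\<Union>n. D n"]) auto
  fix \<psi> assume \<psi>: "\<psi> \<in> dual_space sE"
  interpret sigma_algebra Z \<MM> by fact
  show "(\<lambda>z. blinfun_apply \<psi> (g z)) \<in> borel_measurable (sigma Z \<MM>)"
  proof (rule borel_measurable_LIMSEQ_metric)
    show "(\<lambda>z. blinfun_apply \<psi> (f n z)) \<in> borel_measurable (sigma Z \<MM>)" for n
      using f[of n] \<psi> by (simp add: measurable_functions_def)
    show "(\<lambda>n. blinfun_apply \<psi> (f n z)) \<longlonglongrightarrow> blinfun_apply \<psi> (g z)" if "z \<in> space (sigma Z \<MM>)" for z
      using that by (intro blinfun.tendsto tendsto_const lim) (simp add: space_measure_of_conv)
  qed
qed

section \<open>Semivariation of an i-measure\<close>

text \<open>Links ordered series, in which independent convergence is expressed, to the unordered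
  sums over values that define the simple integral. A large finite set is an initial segment plus a
  remainder beyond \<open>m\<close>, and both the remainder and the tail of the series are
  small.\<close>

lemma has_sum_suminf_of_unconditional_Cauchy:
  fixes a :: "nat \<Rightarrow> 'a::banach"
  assumes "\<And>\<epsilon>. \<epsilon> > 0 \<Longrightarrow> \<exists>m. \<forall>G. finite G \<and> G \<subseteq> {m..} \<longrightarrow> norm (sum a G) < \<epsilon>"
  shows "(a has_sum suminf a) UNIV"
proof -
  have summ: "summable a"
    unfolding summable_Cauchy
  proof (intro allI impI)
    fix e :: real assume "e > 0"
    then obtain m where m: "\<And>G. finite G \<Longrightarrow> G \<subseteq> {m..} \<Longrightarrow> norm (sum a G) < e"
      using assms[OF \<open>e > 0\<close>] by blast
    show "\<exists>N. \<forall>m\<ge>N. \<forall>n. norm (sum a {m..<n}) < e"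
      by (intro exI[of _ m] allI impI m) auto
  qed
  show ?thesis
    unfolding has_sum_def tendsto_iff eventually_finite_subsets_at_top
  proof (intro allI impI)
    fix e :: real assume e: "e > 0"
    then obtain m where m: "\<And>G. finite G \<Longrightarrow> G \<subseteq> {m..} \<Longrightarrow> norm (sum a G) < e / 3"
      using assms[of "e / 3"] by (meson divide_pos_pos zero_less_numeral)
    have tail: "norm (suminf a - sum a {..<m}) \<le> e / 3"
    proof (rule LIMSEQ_le_const2)
      show "(\<lambda>n. norm (sum a {..<n} - sum a {..<m})) \<longlonglongrightarrow> norm (suminf a - sum a {..<m})"
        by (intro tendsto_intros summable_LIMSEQ summ)
      show "\<exists>N. \<forall>n\<ge>N. norm (sum a {..<n} - sum a {..<m}) \<le> e / 3"
      proof (intro exI[of _ m] allI impI)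
        fix n assume "m \<le> n"
        then have "sum a {..<n} = sum a {..<m} + sum a {m..<n}"
          by (metis atLeast0LessThan sum.atLeastLessThan_concat zero_le)
        then show "norm (sum a {..<n} - sum a {..<m}) \<le> e / 3"
          using m[of "{m..<n}"] by fastforce
      qed
    qed
    show "\<exists>X. finite X \<and> X \<subseteq> UNIV \<and>
        (\<forall>Y. finite Y \<and> X \<subseteq> Y \<and> Y \<subseteq> UNIV \<longrightarrow> dist (sum a Y) (suminf a) < e)"
    proof (intro exI[of _ "{..<m}"] conjI allI impI)
      fix Y assume "finite Y \<and> {..<m} \<subseteq> Y \<and> Y \<subseteq> UNIV"
      then have "sum a Y = sum a {..<m} + sum a (Y - {..<m})" and fin: "finite (Y - {..<m})"
        using sum.subset_diff[of "{..<m}" Y a] by (auto simp: add.commute)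
      moreover have "norm (sum a (Y - {..<m})) < e / 3"
        by (rule m[OF fin]) auto
      ultimately show "dist (sum a Y) (suminf a) < e"
        using tail e norm_triangle_ineq4[of "sum a (Y - {..<m})" "suminf a - sum a {..<m}"]
        by (simp add: dist_norm algebra_simps)
    qed auto
  qed
qed

locale operator_measure = sigma_algebra Z \<MM> for Z :: "'z set" and \<MM> +
  fixes \<mu> :: "'z set \<Rightarrow> 'e::real_normed_vector \<Rightarrow>\<^sub>L 'f::banach"
  assumes sums_UN: "range A \<subseteq> \<MM> \<Longrightarrow> disjoint_family A \<Longrightarrow> (\<lambda>n::nat. \<mu> (A n) x) sums \<mu> (\<Union>n. A n) x"
    and summable_bounded: "range A \<subseteq> \<MM> \<Longrightarrow> disjoint_family A \<Longrightarrow> bounded (range y) \<Longrightarrow>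
      summable (\<lambda>n::nat. \<mu> (A n) (y n))"
begin

text \<open>Repeating the empty set gives a disjoint sequence; its constant series converges, so the
  terms vanish.\<close>

lemma measure_empty [simp]: "\<mu> {} = 0"
proof (rule blinfun_eqI)
  fix x
  have "(\<lambda>n::nat. \<mu> {} x) sums \<mu> (\<Union>n::nat. {}) x"
    by (intro sums_UN) (auto simp: disjoint_family_on_def)
  then have "(\<lambda>n::nat. \<mu> {} x) \<longlonglongrightarrow> 0"
    using summable_LIMSEQ_zero sums_summable by blast
  then show "\<mu> {} x = blinfun_apply 0 x"
    by (simp add: LIMSEQ_const_iff)
qed

text \<open>If the criterion failed, there would be successive finite blocks running to infinity
  with sums of norm at least \<open>\<epsilon>\<close>. Replacing \<open>y\<close> by 0 off these
  blocks leaves a bounded sequence whose ordered series still violates the Cauchy condition.\<close>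

lemma unconditional_Cauchy:
  fixes A :: "nat \<Rightarrow> 'z set"
  assumes A: "range A \<subseteq> \<MM>" "disjoint_family A" and y: "bounded (range y)" and "\<epsilon> > 0"
  shows "\<exists>m. \<forall>G. finite G \<and> G \<subseteq> {m..} \<longrightarrow> norm (\<Sum>n\<in>G. \<mu> (A n) (y n)) < \<epsilon>"
proof (rule ccontr)
  assume "\<not> ?thesis"
  then obtain G where G: "\<And>m. finite (G m) \<and> G m \<subseteq> {m..} \<and> norm (\<Sum>n\<in>G m. \<mu> (A n) (y n)) \<ge> \<epsilon>"
    by (metis not_less)
  \<comment> \<open>Inserting \<open>m\<close> keeps the maximum defined and ensures
    \<open>m < nxt m\<close>; the successor puts the whole block \<open>G m\<close> strictly below
    \<open>nxt m\<close>.\<close>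
  define nxt where "nxt m = Suc (Max (insert m (G m)))" for m
  define M where "M k = (nxt ^^ k) 0" for k
  have M_Suc: "M (Suc k) = nxt (M k)" for k
    by (simp add: M_def)
  have lt_nxt: "m < nxt m" "G m \<subseteq> {m..<nxt m}" for m
  proof -
    have fin: "finite (insert m (G m))" using G by auto
    show "m < nxt m" unfolding nxt_def using Max_ge[OF fin, of m] by auto
    show "G m \<subseteq> {m..<nxt m}"
      unfolding nxt_def using Max_ge[OF fin] G by (fastforce simp: less_Suc_eq_le)
  qed
  have "strict_mono M"
    by (simp add: strict_mono_Suc_iff M_Suc lt_nxt)
  define H where "H = (\<Union>k. G (M k))"
  define y' where "y' n = (if n \<in> H then y n else 0)" for n
  have H: "H \<inter> {M k..<M (Suc k)} = G (M k)" for k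
  proof
    show "G (M k) \<subseteq> H \<inter> {M k..<M (Suc k)}"
      using lt_nxt(2)[of "M k"] by (auto simp: H_def M_Suc)
    show "H \<inter> {M k..<M (Suc k)} \<subseteq> G (M k)"
    proof
      fix n assume n: "n \<in> H \<inter> {M k..<M (Suc k)}"
      then obtain j where j: "n \<in> G (M j)" by (auto simp: H_def)
      then have "M j \<le> n" "n < M (Suc j)"
        using lt_nxt(2)[of "M j"] by (auto simp: M_Suc)
      with n have "M j < M (Suc k)" "M k < M (Suc j)"
        by auto
      then have "j = k"
        using strict_mono_less[OF \<open>strict_mono M\<close>] by (metis less_Suc_eq_le le_antisym)
      with j show "n \<in> G (M k)" by simp
    qed
  qed
  have "bounded (range y')"
    using bounded_insert[THEN iffD2, OF y, of 0] by (rule bounded_subset) (auto simp: y'_def)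
  then have "summable (\<lambda>n. \<mu> (A n) (y' n))"
    by (rule summable_bounded[OF A])
  then obtain N where N: "\<And>m n. m \<ge> N \<Longrightarrow> norm (\<Sum>n=m..<n. \<mu> (A n) (y' n)) < \<epsilon>"
    using \<open>\<epsilon> > 0\<close> unfolding summable_Cauchy by meson
  have "(\<Sum>n=M N..<M (Suc N). \<mu> (A n) (y' n)) = (\<Sum>n\<in>G (M N). \<mu> (A n) (y n))"
    unfolding H[symmetric] by (rule sum.mono_neutral_cong_right) (auto simp: y'_def)
  moreover have "M N \<ge> N"
    using \<open>strict_mono M\<close> by (rule strict_mono_imp_increasing)
  ultimately show False
    using N[of "M N" "M (Suc N)"] G[of "M N"] by (simp add: not_less)
qed

text \<open>The family is enumerated by naturals and padded with empty sets and zero vectors, which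
  contribute nothing because \<open>\<mu> {} = 0\<close>. Finite and infinite index sets are thereby
  treated alike.\<close>

lemma summable_on_countable:
  assumes J: "countable J" and C: "\<And>j. j \<in> J \<Longrightarrow> C j \<in> \<MM>" "disjoint_family_on C J"
    and y: "bounded (y ` J)"
  shows "(\<lambda>j. \<mu> (C j) (y j)) summable_on J"
    and "(\<And>j. j \<in> J \<Longrightarrow> y j = x) \<Longrightarrow> ((\<lambda>j. \<mu> (C j) (y j)) has_sum \<mu> (\<Union>j\<in>J. C j) x) J"
proof -
  define i where "i = to_nat_on J"
  define g where "g = from_nat_into J"
  have gi [simp]: "g (i j) = j" if "j \<in> J" for j
    using that J by (simp add: g_def i_def)
  define A where "A n = (if n \<in> i ` J then C (g n) else {})" for n
  define y' where "y' n = (if n \<in> i ` J then y (g n) else 0)" for n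
  have inj: "inj_on i J"
    by (rule inj_on_inverseI[of _ g]) simp
  have A: "range A \<subseteq> \<MM>" "disjoint_family A"
  proof -
    show "range A \<subseteq> \<MM>" using C(1) by (auto simp: A_def)
    have "C j \<inter> C k = {}" if "i j \<noteq> i k" "j \<in> J" "k \<in> J" for j k
      using C(2) that unfolding disjoint_family_on_def by metis
    then show "disjoint_family A"
      by (fastforce simp: A_def disjoint_family_on_def)
  qed
  have "bounded (range y')"
    using bounded_insert[THEN iffD2, OF y, of 0] by (rule bounded_subset) (auto simp: y'_def)
  then have *: "((\<lambda>n. \<mu> (A n) (y' n)) has_sum (\<Sum>n. \<mu> (A n) (y' n))) UNIV"
    by (intro has_sum_suminf_of_unconditional_Cauchy unconditional_Cauchy A) auto
  have "((\<lambda>n. \<mu> (A n) (y' n)) has_sum (\<Sum>n. \<mu> (A n) (y' n))) (i ` J)"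
    using * by (subst has_sum_cong_neutral[where T = UNIV]) (auto simp: A_def)
  then have "((\<lambda>j. \<mu> (A (i j)) (y' (i j))) has_sum (\<Sum>n. \<mu> (A n) (y' n))) J"
    by (simp add: has_sum_reindex[OF inj] o_def)
  then have **: "((\<lambda>j. \<mu> (C j) (y j)) has_sum (\<Sum>n. \<mu> (A n) (y' n))) J"
    by (rule has_sum_cong[THEN iffD1, rotated]) (simp add: A_def y'_def)
  then show "(\<lambda>j. \<mu> (C j) (y j)) summable_on J"
    by (rule has_sum_imp_summable)
  assume x: "\<And>j. j \<in> J \<Longrightarrow> y j = x"
  have "(\<lambda>n. \<mu> (A n) (y' n)) = (\<lambda>n. \<mu> (A n) x)"
    by (auto simp: A_def y'_def x fun_eq_iff)
  then have "(\<Sum>n. \<mu> (A n) (y' n)) = \<mu> (\<Union>n. A n) x"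
    using sums_UN[OF A] by (simp add: sums_iff)
  moreover have "(\<Union>n. A n) = (\<Union>j\<in>J. C j)"
    by (auto simp: A_def)
  ultimately show "((\<lambda>j. \<mu> (C j) (y j)) has_sum \<mu> (\<Union>j\<in>J. C j) x) J"
    using ** by simp
qed

section \<open>Additivity, and continuity along decreasing sets at a fixed vector\<close>

lemma has_sum_UN:
  assumes "countable J" "\<And>j. j \<in> J \<Longrightarrow> C j \<in> \<MM>" "disjoint_family_on C J"
  shows "((\<lambda>j. \<mu> (C j) x) has_sum \<mu> (\<Union>j\<in>J. C j) x) J"
proof -
  have "bounded ((\<lambda>_. x) ` J)"
    by (rule bounded_subset[of "{x}"]) auto
  from summable_on_countable(2)[OF assms this] show ?thesis by simp
qed

lemma Un_disjoint:
  assumes "A \<in> \<MM>" "B \<in> \<MM>" "A \<inter> B = {}"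
  shows "\<mu> (A \<union> B) = \<mu> A + \<mu> B"
proof (rule blinfun_eqI)
  fix x
  have "((\<lambda>j. \<mu> (if j then A else B) x) has_sum \<mu> (\<Union>j\<in>UNIV. if j then A else B) x) UNIV"
  proof (rule has_sum_UN)
    show "disjoint_family (\<lambda>j. if j then A else B)"
      using assms(3) by (auto simp: disjoint_family_on_def)
  qed (use assms in auto)
  moreover have "(\<Union>j\<in>UNIV. if j then A else B) = A \<union> B"
    by (auto split: if_splits)
  ultimately show "\<mu> (A \<union> B) x = blinfun_apply (\<mu> A + \<mu> B) x"
    by (simp add: has_sum_finite_iff UNIV_bool plus_blinfun.rep_eq add.commute)
qed

lemma Diff_subset_eq:
  assumes "A \<in> \<MM>" "B \<in> \<MM>" "B \<subseteq> A"
  shows "\<mu> (A - B) = \<mu> A - \<mu> B"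
proof -
  have "\<mu> ((A - B) \<union> B) = \<mu> (A - B) + \<mu> B"
    using assms by (intro Un_disjoint) auto
  with \<open>B \<subseteq> A\<close> show ?thesis by (simp add: Un_absorb2)
qed

text \<open>The sets \<open>B - A n\<close> increase to \<open>B\<close>, so countable additivity on
  their successive differences applies. The limit is taken for each fixed vector only.\<close>

lemma tendsto_Diff_decseq:
  fixes A :: "nat \<Rightarrow> 'z set"
  assumes "range A \<subseteq> \<MM>" "decseq A" "(\<Inter>n. A n) = {}" "B \<in> \<MM>"
  shows "(\<lambda>n. \<mu> (B - A n) x) \<longlonglongrightarrow> \<mu> B x"
proof -
  define D where "D = disjointed (\<lambda>n. B - A n)"
  have D: "range D \<subseteq> \<MM>" "disjoint_family D"
    unfolding D_def using assms by (auto intro!: range_disjointed_sets disjoint_family_disjointed)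
  have "(\<Union>n. D n) = B"
    unfolding D_def UN_disjointed_eq using assms by auto
  then have "(\<lambda>n. \<Sum>k<n. \<mu> (D k) x) \<longlonglongrightarrow> \<mu> B x"
    using sums_UN[OF D, of x] by (simp add: sums_def)
  \<comment> \<open>The shift by one matches the indices: the pieces up to and including
    \<open>n\<close> together form \<open>B - A n\<close>.\<close>
  then have "(\<lambda>n. \<Sum>k<Suc n. \<mu> (D k) x) \<longlonglongrightarrow> \<mu> B x"
    by (rule LIMSEQ_Suc)
  moreover have "(\<Sum>k<Suc n. \<mu> (D k) x) = \<mu> (B - A n) x" for n
  proof -
    have "((\<lambda>k. \<mu> (D k) x) has_sum \<mu> (\<Union>k<Suc n. D k) x) {..<Suc n}"
      by (rule has_sum_UN) (use D in \<open>auto simp: disjoint_family_on_def\<close>)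
    moreover have "(\<Union>k<Suc n. D k) = B - A n"
    proof -
      have "(\<Union>k<Suc n. D k) = (\<Union>k<Suc n. B - A k)"
        unfolding D_def using finite_UN_disjointed_eq[of "\<lambda>n. B - A n" "Suc n"]
        by (simp add: atLeast0LessThan)
      also have "\<dots> = B - A n"
        using \<open>decseq A\<close> by (fastforce simp: less_Suc_eq_le dest: decseqD)
      finally show ?thesis .
    qed
    ultimately show ?thesis
      by (simp add: has_sum_finite_iff)
  qed
  ultimately show ?thesis by simp
qed

text \<open>A bound instead of a supremum, so that it makes sense before finiteness is known.
  Natural indices suffice, since finite families can be enumerated.\<close>

definition semivariation_le :: "'z set \<Rightarrow> real \<Rightarrow> bool" where
  "semivariation_le A K \<longleftrightarrow> (\<forall>I C x. finite (I::nat set) \<longrightarrow> disjoint_family_on C I \<longrightarrow>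
     (\<forall>i\<in>I. C i \<in> \<MM> \<and> C i \<subseteq> A \<and> norm (x i) \<le> 1) \<longrightarrow> norm (\<Sum>i\<in>I. \<mu> (C i) (x i)) \<le> K)"

text \<open>Enumerate \<open>J\<close> and divide the vectors by \<open>a\<close>; for
  \<open>a = 0\<close> all terms vanish.\<close>

lemma semivariation_leD:
  assumes A: "semivariation_le A K" and J: "finite J" "disjoint_family_on C J"
    and C: "\<And>j. j \<in> J \<Longrightarrow> C j \<in> \<MM>" "\<And>j. j \<in> J \<Longrightarrow> C j \<subseteq> A"
    and x: "\<And>j. j \<in> J \<Longrightarrow> norm (x j) \<le> a" and a: "a \<ge> 0"
  shows "norm (\<Sum>j\<in>J. \<mu> (C j) (x j)) \<le> a * K"
proof (cases "a = 0")
  case True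
  then have "\<mu> (C j) (x j) = 0" if "j \<in> J" for j
    using x[OF that] by simp
  with True show ?thesis by simp
next
  case False
  obtain h :: "nat \<Rightarrow> _" and n where h: "bij_betw h {0..<n} J"
    using ex_bij_betw_nat_finite[OF J(1)] by blast
  have hJ: "h i \<in> J" if "i < n" for i
    using h that by (auto simp: bij_betw_def)
  have "norm (\<Sum>i\<in>{0..<n}. \<mu> (C (h i)) (x (h i) /\<^sub>R a)) \<le> K"
    using A unfolding semivariation_le_def
  proof (elim allE impE)
    show "disjoint_family_on (\<lambda>i. C (h i)) {0..<n}"
      using J(2) h unfolding disjoint_family_on_def bij_betw_def inj_on_def by blast
    show "\<forall>i\<in>{0..<n}. C (h i) \<in> \<MM> \<and> C (h i) \<subseteq> A \<and> norm (x (h i) /\<^sub>R a) \<le> 1"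
      using C hJ x a False by (auto simp: field_simps)
  qed auto
  also have "(\<Sum>i\<in>{0..<n}. \<mu> (C (h i)) (x (h i) /\<^sub>R a)) = (\<Sum>j\<in>J. \<mu> (C j) (x j)) /\<^sub>R a"
    by (subst sum.reindex_bij_betw[OF h, of "\<lambda>j. \<mu> (C j) (x j /\<^sub>R a)"])
       (simp add: blinfun.scaleR_right scaleR_sum_right)
  finally show ?thesis
    using a False by (simp add: field_simps)
qed

lemma semivariation_le_nonneg: "semivariation_le A K \<Longrightarrow> K \<ge> 0"
  using semivariation_leD[of A K "{}::nat set" "\<lambda>_. {}" "\<lambda>_. 0" 1]
  by (auto simp: disjoint_family_on_def)

lemma semivariation_le_subset: "semivariation_le B K \<Longrightarrow> A \<subseteq> B \<Longrightarrow> semivariation_le A K"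
  unfolding semivariation_le_def by (meson subset_trans)

lemma not_semivariation_leE:
  assumes "\<not> semivariation_le A K"
  obtains I :: "nat set" and C x where "finite I" "disjoint_family_on C I"
    "\<And>i. i \<in> I \<Longrightarrow> C i \<in> \<MM>" "\<And>i. i \<in> I \<Longrightarrow> C i \<subseteq> A" "\<And>i. i \<in> I \<Longrightarrow> norm (x i) \<le> 1"
    "norm (\<Sum>i\<in>I. \<mu> (C i) (x i)) > K"
  using assms unfolding semivariation_le_def by (metis not_less)

text \<open>Cut every \<open>C i\<close> along \<open>A\<close>: the parts inside \<open>A\<close>
  and the parts outside, which lie in \<open>B\<close>, are admissible families for the respective
  bounds.\<close>

lemma semivariation_le_Un:
  assumes A: "semivariation_le A K" "A \<in> \<MM>" and B: "semivariation_le B L"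
  shows "semivariation_le (A \<union> B) (K + L)"
  unfolding semivariation_le_def
proof (intro allI impI)
  fix I :: "nat set" and C and x :: "nat \<Rightarrow> 'e"
  assume I: "finite I" "disjoint_family_on C I"
    and C: "\<forall>i\<in>I. C i \<in> \<MM> \<and> C i \<subseteq> A \<union> B \<and> norm (x i) \<le> 1"
  have "(\<Sum>i\<in>I. \<mu> (C i) (x i)) = (\<Sum>i\<in>I. \<mu> (C i \<inter> A) (x i)) + (\<Sum>i\<in>I. \<mu> (C i - A) (x i))"
    unfolding sum.distrib[symmetric]
  proof (rule sum.cong[OF refl])
    fix i assume "i \<in> I"
    then have "\<mu> ((C i \<inter> A) \<union> (C i - A)) = \<mu> (C i \<inter> A) + \<mu> (C i - A)"
      using C A by (intro Un_disjoint) auto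
    then show "\<mu> (C i) (x i) = \<mu> (C i \<inter> A) (x i) + \<mu> (C i - A) (x i)"
      by (simp add: Int_Diff_Un plus_blinfun.rep_eq)
  qed
  moreover have "disjoint_family_on (\<lambda>i. C i \<inter> A) I" "disjoint_family_on (\<lambda>i. C i - A) I"
    by (rule disjoint_family_on_bisimulation[OF I(2)]; blast)+
  then have "norm (\<Sum>i\<in>I. \<mu> (C i \<inter> A) (x i)) \<le> 1 * K"
      "norm (\<Sum>i\<in>I. \<mu> (C i - A) (x i)) \<le> 1 * L"
    using C A(2) I(1) by (intro semivariation_leD[OF A(1)] semivariation_leD[OF B]; auto)+
  ultimately show "norm (\<Sum>i\<in>I. \<mu> (C i) (x i)) \<le> K + L"
    using norm_triangle_ineq[of "\<Sum>i\<in>I. \<mu> (C i \<inter> A) (x i)" "\<Sum>i\<in>I. \<mu> (C i - A) (x i)"] by simp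
qed

lemma semivariation_le_UN:
  assumes "finite I" "\<And>i. i \<in> I \<Longrightarrow> C i \<in> \<MM>" "\<And>i. i \<in> I \<Longrightarrow> \<exists>K. semivariation_le (C i) K"
  shows "\<exists>K. semivariation_le (\<Union>i\<in>I. C i) K"
  using assms
proof (induction I)
  case empty
  have "semivariation_le {} 0"
    unfolding semivariation_le_def by (auto intro!: order.eq_iff[THEN iffD1, THEN conjunct1] sum.neutral)
  then show ?case by auto
next
  case (insert i I)
  then show ?case
    using semivariation_le_Un[of "C i"] by (simp add: Union_image_insert) (metis insertI1)
qed

text \<open>Gliding hump: mass of size \<open>c\<close> on each of infinitely many disjoint sets would make a
  series \<open>\<Sum> \<mu>(A\<^sub>n) x\<^sub>n\<close> over the union of all the partitions fail the unconditional Cauchy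
  criterion.\<close>

lemma semivariation_hump:
  fixes D :: "nat \<Rightarrow> 'z set"
  assumes "disjoint_family D" "c > 0"
  shows "\<exists>k. semivariation_le (D k) c"
proof (rule ccontr)
  assume *: "\<not> ?thesis"
  define H where "H k I C x \<longleftrightarrow> finite I \<and> disjoint_family_on C I \<and>
    (\<forall>i\<in>I. C i \<in> \<MM> \<and> C i \<subseteq> D k \<and> norm (x i) \<le> 1) \<and> norm (\<Sum>i\<in>I. \<mu> (C i) (x i)) > c"
    for k and I :: "nat set" and C x
  have "\<exists>I C x. H k I C x" for k
  proof -
    have "\<not> semivariation_le (D k) c" using * by blast
    then show ?thesis by (simp add: semivariation_le_def H_def not_le)
  qed
  then obtain I C x where "\<And>k. H k (I k) (C k) (x k)"
    by metis
  then have I: "\<And>k. finite (I k)" "\<And>k. disjoint_family_on (C k) (I k)"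
    and C: "\<And>k i. i \<in> I k \<Longrightarrow> C k i \<in> \<MM>" "\<And>k i. i \<in> I k \<Longrightarrow> C k i \<subseteq> D k"
    and x: "\<And>k i. i \<in> I k \<Longrightarrow> norm (x k i) \<le> 1"
    and c: "\<And>k. norm (\<Sum>i\<in>I k. \<mu> (C k i) (x k i)) > c"
    by (simp_all add: H_def)
  \<comment> \<open>Pairing flattens the doubly indexed family into a sequence; pairs outside the
    finite index sets get the empty set and the vector 0.\<close>
  define A where "A n = (case prod_decode n of (k, i) \<Rightarrow> if i \<in> I k then C k i else {})" for n
  define y where "y n = (case prod_decode n of (k, i) \<Rightarrow> if i \<in> I k then x k i else 0)" for n
  have "range A \<subseteq> \<MM>"
    using C by (auto simp: A_def split: prod.splits)
  moreover have "disjoint_family A"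
    unfolding disjoint_family_on_def
  proof (intro ballI impI)
    fix m n :: nat assume "m \<noteq> n"
    obtain k i l j where *: "prod_decode m = (k, i)" "prod_decode n = (l, j)"
      by fastforce
    with \<open>m \<noteq> n\<close> have "(k, i) \<noteq> (l, j)"
      by (metis prod_decode_inverse)
    show "A m \<inter> A n = {}"
    proof (cases "k = l")
      case True
      with \<open>(k, i) \<noteq> (l, j)\<close> I(2)[of k] show ?thesis
        by (auto simp: A_def * disjoint_family_on_def)
    next
      case False
      then have "D k \<inter> D l = {}"
        using assms(1) by (auto simp: disjoint_family_on_def)
      then show ?thesis
        using C(2) by (auto simp: A_def *)
    qed
  qed
  moreover have "bounded (range y)"
    unfolding bounded_iff using x by (intro exI[of _ 1]) (auto simp: y_def split: prod.splits)
  ultimately have "\<exists>m. \<forall>G. finite G \<and> G \<subseteq> {m..} \<longrightarrow> norm (\<Sum>n\<in>G. \<mu> (A n) (y n)) < c"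
    using \<open>c > 0\<close> by (rule unconditional_Cauchy)
  then obtain m where m: "\<And>G. finite G \<Longrightarrow> G \<subseteq> {m..} \<Longrightarrow> norm (\<Sum>n\<in>G. \<mu> (A n) (y n)) < c"
    by metis
  \<comment> \<open>As \<open>prod_encode (m, i)\<close> is at least \<open>m\<close>, the hump with
    number \<open>m\<close> lies wholly in the tail beyond \<open>m\<close>, where all finite sums
    are smaller than \<open>c\<close>.\<close>
  define G where "G = (\<lambda>i. prod_encode (m, i)) ` I m"
  have "(\<Sum>n\<in>G. \<mu> (A n) (y n)) = (\<Sum>i\<in>I m. \<mu> (C m i) (x m i))"
    unfolding G_def by (subst sum.reindex) (auto simp: inj_on_def A_def y_def)
  moreover have "G \<subseteq> {m..}"
    by (auto simp: G_def le_prod_encode_1)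
  ultimately show False
    using m[of G] c[of m] I by (auto simp: G_def)
qed

lemma semivariation_hump_decseq:
  fixes A :: "nat \<Rightarrow> 'z set"
  assumes "decseq A" "c > 0"
  shows "\<exists>k. semivariation_le (A k - A (Suc k)) c"
proof (rule semivariation_hump[OF _ \<open>c > 0\<close>])
  have "(A m - A (Suc m)) \<inter> (A n - A (Suc n)) = {}" if "m < n" for m n
    using decseqD[OF \<open>decseq A\<close> Suc_leI[OF that]] by blast
  then show "disjoint_family (\<lambda>k. A k - A (Suc k))"
    unfolding disjoint_family_on_def by (metis Int_commute linorder_neqE_nat)
qed

text \<open>The common engine of the next proofs: \<open>P\<close> expresses badness, and dependent
  choice produces a decreasing sequence of bad sets whose successive differences all carry
  humps.\<close>

lemma semivariation_hump_descent:
  assumes start: "P A" and c: "c > 0"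
    and step: "\<And>A. P A \<Longrightarrow> \<exists>B. P B \<and> B \<subseteq> A \<and> \<not> semivariation_le (A - B) c"
  shows False
proof -
  obtain S :: "nat \<Rightarrow> _" where S: "\<And>n. P (S n)" "\<And>n. S (Suc n) \<subseteq> S n"
      "\<And>n. \<not> semivariation_le (S n - S (Suc n)) c"
    using dependent_nat_choice[of "\<lambda>_. P" "\<lambda>_ A B. B \<subseteq> A \<and> \<not> semivariation_le (A - B) c"] start step
    by metis
  have "decseq S"
    using S(2) by (rule decseq_SucI)
  then show False
    using semivariation_hump_decseq[of S c] S(3) c by blast
qed

section \<open>Boundedness of the measure, finiteness and continuity of its semivariation\<close>

lemma norm_le_semivariation:
  assumes "semivariation_le A K" "A \<in> \<MM>"
  shows "norm (\<mu> A) \<le> K"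
proof (rule norm_blinfun_bound)
  show "K \<ge> 0" using assms(1) by (rule semivariation_le_nonneg)
  fix x
  show "norm (\<mu> A x) \<le> K * norm x"
    using semivariation_leD[OF assms(1), of "{0::nat}" "\<lambda>_. A" "\<lambda>_. x" "norm x"] assms(2)
    by (simp add: disjoint_family_on_def mult.commute)
qed

text \<open>Badness of \<open>A\<close> means that \<open>\<mu>\<close> is unbounded on its
  measurable subsets. A subset \<open>B\<close> of very large measure splits \<open>A\<close> into
  two parts that are both humps; one of them is bad again and the other is cut off.\<close>

lemma norm_bounded: "\<exists>K. \<forall>A\<in>\<MM>. norm (\<mu> A) \<le> K"
proof (rule ccontr)
  assume *: "\<not> ?thesis"
  define P where "P A \<longleftrightarrow> A \<in> \<MM> \<and> (\<forall>K. \<exists>B\<in>\<MM>. B \<subseteq> A \<and> norm (\<mu> B) > K)" for A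
  show False
  proof (rule semivariation_hump_descent[of P Z 1])
    show "P Z"
      using * sets_into_space by (fastforce simp: P_def not_le)
    fix A assume A: "P A"
    \<comment> \<open>The excess over \<open>norm (\<mu> A)\<close> makes the complement large too:
      \<open>norm (\<mu> A - \<mu> B) > 1\<close>.\<close>
    then obtain B where B: "B \<in> \<MM>" "B \<subseteq> A" "norm (\<mu> B) > 1 + norm (\<mu> A)"
      unfolding P_def by blast
    have "A \<in> \<MM>" using A by (simp add: P_def)
    have big: "norm (\<mu> (A - B)) > 1" "norm (\<mu> B) > 1"
      using B \<open>A \<in> \<MM>\<close> norm_triangle_ineq2[of "\<mu> B" "\<mu> A"]
      by (auto simp: Diff_subset_eq norm_minus_commute intro: order.strict_trans2 add_increasing2)
         (smt (verit) norm_ge_zero)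
    have "P B \<or> P (A - B)"
    proof (rule ccontr)
      assume "\<not> (P B \<or> P (A - B))"
      then obtain K L where K: "\<And>C. C \<in> \<MM> \<Longrightarrow> C \<subseteq> B \<Longrightarrow> norm (\<mu> C) \<le> K"
        and L: "\<And>C. C \<in> \<MM> \<Longrightarrow> C \<subseteq> A - B \<Longrightarrow> norm (\<mu> C) \<le> L"
        using B \<open>A \<in> \<MM>\<close> unfolding P_def by (metis Diff not_less)
      obtain C where C: "C \<in> \<MM>" "C \<subseteq> A" "norm (\<mu> C) > K + L"
        using A unfolding P_def by blast
      have "\<mu> C = \<mu> ((C \<inter> B) \<union> (C - B))"
        by (simp add: Int_Diff_Un)
      also have "\<dots> = \<mu> (C \<inter> B) + \<mu> (C - B)"
        using B C by (intro Un_disjoint) auto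
      finally have "norm (\<mu> C) \<le> norm (\<mu> (C \<inter> B)) + norm (\<mu> (C - B))"
        by (simp add: norm_triangle_ineq)
      moreover have "norm (\<mu> (C \<inter> B)) \<le> K" "norm (\<mu> (C - B)) \<le> L"
        using B C by (auto intro!: K L)
      ultimately show False using C(3) by linarith
    qed
    then show "\<exists>B. P B \<and> B \<subseteq> A \<and> \<not> semivariation_le (A - B) 1"
    proof
      assume "P B"
      then show ?thesis
        using B big norm_le_semivariation[of "A - B" 1] \<open>A \<in> \<MM>\<close> by (intro exI[of _ B]) auto
    next
      assume "P (A - B)"
      moreover have "A - (A - B) = B" using B by auto
      ultimately show ?thesis
        using B big norm_le_semivariation[of B 1] by (intro exI[of _ "A - B"]) auto
    qed
  qed simp
qed

text \<open>A bad set has infinite semivariation. It is the union of the pieces of a large finite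
  sum and a remainder \<open>R\<close>, so by subadditivity one of these is bad. If it is
  \<open>R\<close>, all the pieces form the hump; if it is a piece, the others do.\<close>

lemma semivariation_finite: "\<exists>K. semivariation_le Z K"
proof (rule ccontr)
  assume *: "\<not> ?thesis"
  define P where "P A \<longleftrightarrow> A \<in> \<MM> \<and> (\<nexists>K. semivariation_le A K)" for A
  obtain K where K: "\<And>A. A \<in> \<MM> \<Longrightarrow> norm (\<mu> A) \<le> K"
    using norm_bounded by blast
  have "K \<ge> 0" using K[of "{}"] by simp
  show False
  proof (rule semivariation_hump_descent[of P Z 1])
    show "P Z" using * by (simp add: P_def)
    fix A assume A: "P A"
    \<comment> \<open>The margin \<open>K\<close> pays for dropping one piece, whose term has norm
      at most \<open>K\<close>; more than 1 remains.\<close>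
    then have "\<not> semivariation_le A (K + 1)" by (auto simp: P_def)
    then obtain I :: "nat set" and C x where I: "finite I" "disjoint_family_on C I"
      and C: "\<And>i. i \<in> I \<Longrightarrow> C i \<in> \<MM>" "\<And>i. i \<in> I \<Longrightarrow> C i \<subseteq> A"
      and x: "\<And>i. i \<in> I \<Longrightarrow> norm (x i) \<le> 1"
      and hump: "norm (\<Sum>i\<in>I. \<mu> (C i) (x i)) > K + 1"
      by (rule not_semivariation_leE) blast
    define R where "R = A - (\<Union>i\<in>I. C i)"
    have UN: "(\<Union>i\<in>I. C i) \<in> \<MM>" using C I by auto
    then have R: "R \<in> \<MM>" using A by (auto simp: R_def P_def)
    have hump_on: "\<not> semivariation_le B 1" if "J \<subseteq> I" "\<And>i. i \<in> J \<Longrightarrow> C i \<subseteq> B"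
      "norm (\<Sum>i\<in>J. \<mu> (C i) (x i)) > 1" for B J
    proof
      assume "semivariation_le B 1"
      then have "norm (\<Sum>i\<in>J. \<mu> (C i) (x i)) \<le> 1 * 1"
        using that C x finite_subset[OF that(1) I(1)] disjoint_family_on_mono[OF that(1) I(2)]
        by (intro semivariation_leD) auto
      with that(3) show False by simp
    qed
    have "P R \<or> (\<exists>i\<in>I. P (C i))"
    proof (rule ccontr)
      assume "\<not> (P R \<or> (\<exists>i\<in>I. P (C i)))"
      then obtain L where "semivariation_le R L" "\<And>i. i \<in> I \<Longrightarrow> \<exists>K. semivariation_le (C i) K"
        using R C by (auto simp: P_def)
      moreover obtain L' where "semivariation_le (\<Union>i\<in>I. C i) L'"
        using semivariation_le_UN[of I C] calculation C I by blast
      ultimately have "semivariation_le (R \<union> (\<Union>i\<in>I. C i)) (L + L')"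
        using R by (intro semivariation_le_Un)
      moreover have "R \<union> (\<Union>i\<in>I. C i) = A" using C by (auto simp: R_def)
      ultimately show False using A by (auto simp: P_def)
    qed
    then show "\<exists>B. P B \<and> B \<subseteq> A \<and> \<not> semivariation_le (A - B) 1"
    proof
      assume "P R"
      moreover have "\<not> semivariation_le (A - R) 1"
        using hump \<open>K \<ge> 0\<close> C by (intro hump_on[of I]) (auto simp: R_def)
      ultimately show ?thesis by (auto simp: R_def)
    next
      assume "\<exists>i\<in>I. P (C i)"
      then obtain i where i: "i \<in> I" "P (C i)" by blast
      have "norm (\<mu> (C i) (x i)) \<le> norm (\<mu> (C i)) * norm (x i)"
        by (rule norm_blinfun)
      also have "\<dots> \<le> K * 1"
        using i C K x \<open>K \<ge> 0\<close> by (intro mult_mono) auto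
      finally have "norm (\<mu> (C i) (x i)) \<le> K" by simp
      moreover have "(\<Sum>i\<in>I. \<mu> (C i) (x i)) = \<mu> (C i) (x i) + (\<Sum>i\<in>I - {i}. \<mu> (C i) (x i))"
        using I i by (simp add: sum.remove)
      ultimately have "norm (\<Sum>i\<in>I - {i}. \<mu> (C i) (x i)) > 1"
        using hump norm_triangle_ineq[of "\<mu> (C i) (x i)" "\<Sum>i\<in>I - {i}. \<mu> (C i) (x i)"] by simp
      then have "\<not> semivariation_le (A - C i) 1"
        using C I(2) i by (intro hump_on[of "I - {i}"]) (auto dest: disjoint_family_onD)
      then show ?thesis using i C by auto
    qed
  qed simp
qed

text \<open>A sum exceeding \<open>c\<close> on \<open>A n\<close> involves finitely many sets and
  vectors, so convergence at each vector shows that it still exceeds \<open>c\<close> after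
  \<open>A m\<close> is removed from the sets, for large \<open>m\<close>. The hump then sits on
  \<open>A n - A m\<close>, and the descent runs within the sequence \<open>A\<close>.\<close>

lemma semivariation_continuous:
  fixes A :: "nat \<Rightarrow> 'z set"
  assumes A: "range A \<subseteq> \<MM>" "decseq A" "(\<Inter>n. A n) = {}" and c: "c > 0"
  shows "\<exists>n. semivariation_le (A n) c"
proof (rule ccontr)
  assume *: "\<not> ?thesis"
  show False
  proof (rule semivariation_hump_descent[of "\<lambda>B. B \<in> range A" "A 0" c])
    fix B assume "B \<in> range A"
    then obtain n where n: "B = A n" by blast
    obtain I :: "nat set" and C x where I: "finite I" "disjoint_family_on C I"
      and C: "\<And>i. i \<in> I \<Longrightarrow> C i \<in> \<MM>" "\<And>i. i \<in> I \<Longrightarrow> C i \<subseteq> A n"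
      and x: "\<And>i. i \<in> I \<Longrightarrow> norm (x i) \<le> 1"
      and hump: "norm (\<Sum>i\<in>I. \<mu> (C i) (x i)) > c"
      by (rule not_semivariation_leE[of "A n" c]) (use * in blast)+
    have "(\<lambda>m. norm (\<Sum>i\<in>I. \<mu> (C i - A m) (x i))) \<longlonglongrightarrow> norm (\<Sum>i\<in>I. \<mu> (C i) (x i))"
      using A C by (intro tendsto_norm tendsto_sum tendsto_Diff_decseq)
    then have "eventually (\<lambda>m. norm (\<Sum>i\<in>I. \<mu> (C i - A m) (x i)) > c) sequentially"
      using hump by (rule order_tendstoD)
    moreover have "eventually (\<lambda>m. m \<ge> n) sequentially"
      by (rule eventually_ge_at_top)
    ultimately obtain m where m: "m \<ge> n" "norm (\<Sum>i\<in>I. \<mu> (C i - A m) (x i)) > c"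
      by (metis (mono_tags, lifting) eventually_conj eventually_sequentially order_refl)
    have "\<not> semivariation_le (A n - A m) c"
    proof
      assume "semivariation_le (A n - A m) c"
      then have "norm (\<Sum>i\<in>I. \<mu> (C i - A m) (x i)) \<le> 1 * c"
        using I(1) C x range_subsetD[OF A(1), of m]
        by (intro semivariation_leD) (auto intro: Diff disjoint_family_on_bisimulation[OF I(2)])
      with m show False by simp
    qed
    then show "\<exists>B'. B' \<in> range A \<and> B' \<subseteq> B \<and> \<not> semivariation_le (B - B') c"
      using decseqD[OF A(2) m(1)] n by blast
  qed (use c in auto)
qed

end

section \<open>The integral and its continuity\<close>

lemma norm_le_sup_norm:
  assumes "f \<in> bounded_functions Z" "g \<in> bounded_functions Z" "z \<in> Z"
  shows "norm (f z - g z) \<le> sup_norm Z (\<lambda>z. f z - g z)"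
proof -
  obtain a b where a: "\<And>z. z \<in> Z \<Longrightarrow> norm (f z) \<le> a" and b: "\<And>z. z \<in> Z \<Longrightarrow> norm (g z) \<le> b"
    using assms by (auto simp: bounded_functions_def bounded_iff)
  have "norm (f z - g z) \<le> a + b" if "z \<in> Z" for z
    using a[OF that] b[OF that] norm_triangle_ineq4[of "f z" "g z"] by linarith
  then have "bdd_above ((\<lambda>z. norm (f z - g z)) ` Z)"
    by (rule bdd_aboveI2)
  with \<open>z \<in> Z\<close> show ?thesis
    unfolding sup_norm_def by (intro cSup_upper) auto
qed

lemma sup_norm_le:
  assumes "\<And>z. z \<in> Z \<Longrightarrow> norm (f z) \<le> a" "a \<ge> 0"
  shows "sup_norm Z f \<le> a"
  unfolding sup_norm_def using assms by (intro cSup_least) auto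

context operator_measure
begin

text \<open>Change of variables: the integral may be summed over a partition finer than the level
  sets of \<open>f\<close>. Cells of \<open>h\<close> with the same \<open>\<phi>\<close>-value
  carry the same vector, so each group sums up by countable additivity. This allows two functions to
  be integrated over one partition.\<close>

lemma simple_integral_comp:
  assumes h: "countable (h ` Z)" "\<And>b. h -` {b} \<inter> Z \<in> \<MM>"
    and \<phi>: "bounded (\<phi> ` h ` Z)" and f: "\<And>z. z \<in> Z \<Longrightarrow> f z = \<phi> (h z)"
  shows "((\<lambda>b. \<mu> (h -` {b} \<inter> Z) (\<phi> b)) has_sum simple_integral Z \<mu> f) (h ` Z)"
proof -
  define C where "C b = h -` {b} \<inter> Z" for b
  define T where "T = Sigma (f ` Z) (\<lambda>e. {b \<in> h ` Z. \<phi> b = e})"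
  have C: "C b \<in> \<MM>" "disjoint_family_on C B" for b B
    using h(2) by (auto simp: C_def disjoint_family_on_def)
  have "(\<lambda>b. \<mu> (C b) (\<phi> b)) summable_on h ` Z"
    using h(1) C \<phi> by (intro summable_on_countable(1)) auto
  then obtain S where S: "((\<lambda>b. \<mu> (C b) (\<phi> b)) has_sum S) (h ` Z)"
    by (auto simp: summable_on_def)
  have inj: "inj_on (\<lambda>b. (\<phi> b, b)) (h ` Z)"
    by (auto simp: inj_on_def)
  have "(\<lambda>b. (\<phi> b, b)) ` h ` Z = T"
    unfolding T_def using f by (auto simp: image_iff) metis
  then have "((\<lambda>(e, b). \<mu> (C b) e) has_sum S) T"
    using S has_sum_reindex[OF inj, of "\<lambda>(e, b). \<mu> (C b) e" S] by (simp add: o_def)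
  then have "((\<lambda>e. \<mu> (f -` {e} \<inter> Z) e) has_sum S) (f ` Z)"
    unfolding T_def
  proof (rule has_sum_SigmaD)
    fix e assume "e \<in> f ` Z"
    have "((\<lambda>b. \<mu> (C b) e) has_sum \<mu> (\<Union>b\<in>{b \<in> h ` Z. \<phi> b = e}. C b) e) {b \<in> h ` Z. \<phi> b = e}"
    proof (rule has_sum_UN[OF _ C])
      show "countable {b \<in> h ` Z. \<phi> b = e}"
        using h(1) by (rule countable_subset[rotated]) auto
    qed
    moreover have "(\<Union>b\<in>{b \<in> h ` Z. \<phi> b = e}. C b) = f -` {e} \<inter> Z"
      using f by (auto simp: C_def)
    ultimately show "((\<lambda>b. case (e, b) of (e, b) \<Rightarrow> \<mu> (C b) e) has_sum \<mu> (f -` {e} \<inter> Z) e)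
        {b \<in> h ` Z. \<phi> b = e}"
      by simp
  qed
  moreover have "f -` {e} \<inter> Z = {}" if "e \<notin> f ` Z" for e
    using that by auto
  ultimately have "((\<lambda>e. \<mu> (f -` {e} \<inter> Z) e) has_sum S) UNIV"
    by (subst has_sum_cong_neutral[where T = "f ` Z"]) auto
  then have "simple_integral Z \<mu> f = S"
    unfolding simple_integral_def by (rule infsumI)
  with S show ?thesis by (simp add: C_def)
qed

text \<open>The quantitative core of the convergence theorem: the difference may be large on
  \<open>A\<close> if the semivariation there is small. Finite partial sums over a common refinement
  split into cells inside and outside \<open>A\<close>, and the bound survives the limit.\<close>

lemma simple_integral_diff_le:
  assumes f: "f \<in> simple_functions Z \<MM>" and g: "g \<in> simple_functions Z \<MM>" and A: "A \<in> \<MM>"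
    and a: "\<And>z. z \<in> Z - A \<Longrightarrow> norm (f z - g z) \<le> a" "a \<ge> 0"
    and b: "\<And>z. z \<in> A \<Longrightarrow> norm (f z - g z) \<le> b" "b \<ge> 0"
    and K: "semivariation_le Z K" and d: "semivariation_le A d"
  shows "norm (simple_integral Z \<mu> f - simple_integral Z \<mu> g) \<le> a * K + b * d"
proof -
  \<comment> \<open>Its level sets refine those of \<open>f\<close> and of \<open>g\<close>, and
    each of them lies inside \<open>A\<close> or misses it.\<close>
  define h where "h z = (f z, g z, z \<in> A)" for z
  define C where "C p = h -` {p} \<inter> Z" for p
  define v where "v p = fst p - fst (snd p)" for p :: "'e \<times> 'e \<times> bool"
  have cnt: "countable (h ` Z)"
  proof (rule countable_subset)
    show "h ` Z \<subseteq> f ` Z \<times> g ` Z \<times> UNIV" by (auto simp: h_def)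
    show "countable (f ` Z \<times> g ` Z \<times> (UNIV :: bool set))"
      using f g by (auto simp: simple_functions_def)
  qed
  have C: "C p \<in> \<MM>" for p
  proof -
    obtain x y t where p: "p = (x, y, t)" by (cases p)
    have "C p = (f -` {x} \<inter> Z) \<inter> (g -` {y} \<inter> Z) \<inter> (if t then A else Z - A)"
      by (auto simp: C_def h_def p)
    also have "\<dots> \<in> \<MM>"
      using f g A by (auto simp: simple_functions_def)
    finally show ?thesis .
  qed
  have CZ: "C p \<subseteq> Z" for p
    by (auto simp: C_def)
  have disj: "disjoint_family_on C P" for P
    by (auto simp: C_def disjoint_family_on_def)
  have "((\<lambda>p. \<mu> (C p) (fst p)) has_sum simple_integral Z \<mu> f) (h ` Z)"
    unfolding C_def
    by (rule simple_integral_comp[OF cnt])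
       (use f C in \<open>auto simp: C_def h_def image_image simple_functions_def bounded_functions_def\<close>)
  moreover have "((\<lambda>p. \<mu> (C p) (fst (snd p))) has_sum simple_integral Z \<mu> g) (h ` Z)"
    unfolding C_def
    by (rule simple_integral_comp[OF cnt])
       (use g C in \<open>auto simp: C_def h_def image_image simple_functions_def bounded_functions_def\<close>)
  ultimately have "((\<lambda>p. \<mu> (C p) (fst p) + - \<mu> (C p) (fst (snd p))) has_sum
      (simple_integral Z \<mu> f + - simple_integral Z \<mu> g)) (h ` Z)"
    by (intro has_sum_add) (simp_all add: has_sum_uminus)
  then have sum: "((\<lambda>p. \<mu> (C p) (v p)) has_sum (simple_integral Z \<mu> f - simple_integral Z \<mu> g)) (h ` Z)"
    by (simp add: v_def blinfun.diff_right)
  have bound: "norm (\<Sum>p\<in>P. \<mu> (C p) (v p)) \<le> a * K + b * d" if P: "finite P" "P \<subseteq> h ` Z" for P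
  proof -
    have inA: "norm (v p) \<le> b \<and> C p \<subseteq> A" if "p \<in> P" "snd (snd p)" for p
      using that P b(1) by (auto simp: C_def h_def v_def)
    have outA: "norm (v p) \<le> a" if "p \<in> P" "\<not> snd (snd p)" for p
      using that P a(1) by (auto simp: h_def v_def)
    have "(\<Sum>p\<in>P. \<mu> (C p) (v p)) =
        (\<Sum>p\<in>{p \<in> P. \<not> snd (snd p)}. \<mu> (C p) (v p)) + (\<Sum>p\<in>{p \<in> P. snd (snd p)}. \<mu> (C p) (v p))"
      using P(1) by (subst sum.union_disjoint[symmetric]) (auto intro: sum.cong)
    moreover have "norm (\<Sum>p\<in>{p \<in> P. \<not> snd (snd p)}. \<mu> (C p) (v p)) \<le> a * K"
      by (rule semivariation_leD[OF K]) (use P C CZ disj outA a in auto)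
    moreover have "norm (\<Sum>p\<in>{p \<in> P. snd (snd p)}. \<mu> (C p) (v p)) \<le> b * d"
      by (rule semivariation_leD[OF d]) (use P C disj inA b in auto)
    ultimately show ?thesis
      using norm_triangle_ineq by (smt (verit))
  qed
  show ?thesis
  proof (rule tendsto_upperbound)
    show "((\<lambda>P. norm (\<Sum>p\<in>P. \<mu> (C p) (v p))) \<longlongrightarrow>
        norm (simple_integral Z \<mu> f - simple_integral Z \<mu> g)) (finite_subsets_at_top (h ` Z))"
      using sum unfolding has_sum_def by (rule tendsto_norm)
  qed (use bound in auto)
qed

section \<open>Extension of the integral from simple to measurable functions\<close>

lemma simple_integral_Lipschitz:
  assumes "f \<in> simple_functions Z \<MM>" "g \<in> simple_functions Z \<MM>" "semivariation_le Z K"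
    and "\<And>z. z \<in> Z \<Longrightarrow> norm (f z - g z) \<le> a" "a \<ge> 0"
  shows "norm (simple_integral Z \<mu> f - simple_integral Z \<mu> g) \<le> a * K"
  using simple_integral_diff_le[of f g "{}" a 0 K K] semivariation_le_subset[of Z K "{}"] assms by simp

text \<open>\<open>L\<close> is the value of the integral at \<open>f\<close>, found as the limit
  along one approximating sequence. The error bound for every approximant shows that the choice of
  the sequence is immaterial.\<close>

lemma simple_integral_extends:
  fixes sE :: "'k::real_or_complex \<Rightarrow> 'e \<Rightarrow> 'e"
  assumes E: "normed_space_over sE" and K: "semivariation_le Z K"
    and f: "f \<in> measurable_functions sE Z \<MM>"
  shows "\<exists>L. \<forall>s\<in>simple_functions Z \<MM>. \<forall>e\<ge>0. (\<forall>z\<in>Z. norm (s z - f z) \<le> e) \<longrightarrow>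
    norm (simple_integral Z \<mu> s - L) \<le> e * K"
proof -
  have "K \<ge> 0" using K by (rule semivariation_le_nonneg)
  have "\<exists>s. s \<in> simple_functions Z \<MM> \<and> (\<forall>z\<in>Z. norm (s z - f z) \<le> inverse (Suc n))" for n
    by (rule simple_functions_dense[OF E sigma_algebra_axioms f, of "inverse (Suc n)"]) auto
  then obtain s where s: "\<And>n. s n \<in> simple_functions Z \<MM>"
      "\<And>n z. z \<in> Z \<Longrightarrow> norm (s n z - f z) \<le> inverse (Suc n)"
    by metis
  have dist: "norm (simple_integral Z \<mu> t - simple_integral Z \<mu> (s n)) \<le> (e + inverse (Suc n)) * K"
    if "t \<in> simple_functions Z \<MM>" "\<forall>z\<in>Z. norm (t z - f z) \<le> e" "e \<ge> 0" for t e n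
  proof (rule simple_integral_Lipschitz[OF that(1) s(1) K])
    fix z assume "z \<in> Z"
    then show "norm (t z - s n z) \<le> e + inverse (Suc n)"
      using s(2)[of z n] that(2) norm_triangle_ineq4[of "t z - f z" "s n z - f z"] by fastforce
  qed (use that in simp)
  have "Cauchy (\<lambda>n. simple_integral Z \<mu> (s n))"
  proof (rule CauchyI)
    fix e :: real assume "e > 0"
    \<comment> \<open>Here and below \<open>K + 1\<close> replaces \<open>K\<close> to avoid
      division by zero and to obtain strict inequalities.\<close>
    obtain N where N: "inverse (Suc N) < e / (2 * (K + 1))"
      using reals_Archimedean[of "e / (2 * (K + 1))"] \<open>e > 0\<close> \<open>K \<ge> 0\<close> by auto
    show "\<exists>M. \<forall>m\<ge>M. \<forall>n\<ge>M. norm (simple_integral Z \<mu> (s m) - simple_integral Z \<mu> (s n)) < e"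
    proof (intro exI[of _ N] allI impI)
      fix m n assume mn: "m \<ge> N" "n \<ge> N"
      have "norm (simple_integral Z \<mu> (s m) - simple_integral Z \<mu> (s n))
          \<le> (inverse (Suc m) + inverse (Suc n)) * K"
        using s by (intro dist) auto
      also have "\<dots> \<le> (inverse (Suc N) + inverse (Suc N)) * (K + 1)"
        using mn \<open>K \<ge> 0\<close> by (intro mult_mono add_mono) (auto intro: le_imp_inverse_le)
      also have "\<dots> < e"
        using N \<open>K \<ge> 0\<close> by (simp add: field_simps)
      finally show "norm (simple_integral Z \<mu> (s m) - simple_integral Z \<mu> (s n)) < e" .
    qed
  qed
  then obtain L where L: "(\<lambda>n. simple_integral Z \<mu> (s n)) \<longlonglongrightarrow> L"
    using Cauchy_convergent convergent_def by blast
  show ?thesis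
  proof (intro exI[of _ L] ballI allI impI)
    fix t e assume t: "t \<in> simple_functions Z \<MM>" "e \<ge> 0" "\<forall>z\<in>Z. norm (t z - f z) \<le> e"
    have "(\<lambda>n. norm (simple_integral Z \<mu> t - simple_integral Z \<mu> (s n)))
        \<longlonglongrightarrow> norm (simple_integral Z \<mu> t - L)"
      by (intro tendsto_norm tendsto_diff tendsto_const L)
    moreover have "(\<lambda>n. (e + inverse (Suc n)) * K) \<longlonglongrightarrow> (e + 0) * K"
      by (intro tendsto_mult tendsto_add tendsto_const LIMSEQ_inverse_real_of_nat)
    ultimately have "norm (simple_integral Z \<mu> t - L) \<le> (e + 0) * K"
      by (rule LIMSEQ_le) (use dist t in auto)
    then show "norm (simple_integral Z \<mu> t - L) \<le> e * K" by simp
  qed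
qed

text \<open>Makes the definite description usable. The values \<open>L\<close> define a Lipschitz
  map \<open>J\<close> on the measurable functions; any other continuous extension agrees with it on
  the dense simple functions, hence everywhere.\<close>

lemma i_integral_approx:
  fixes sE :: "'k::real_or_complex \<Rightarrow> 'e \<Rightarrow> 'e"
  assumes E: "normed_space_over sE" and K: "semivariation_le Z K"
    and "f \<in> measurable_functions sE Z \<MM>" "s \<in> simple_functions Z \<MM>"
    and "\<And>z. z \<in> Z \<Longrightarrow> norm (s z - f z) \<le> e" "e \<ge> 0"
  shows "norm (simple_integral Z \<mu> s - i_integral sE Z \<MM> \<mu> f) \<le> e * K"
proof -
  define M where "M = measurable_functions sE Z \<MM>"
  define S where "S = (simple_functions Z \<MM> :: ('z \<Rightarrow> 'e) set)"
  have "K \<ge> 0" using K by (rule semivariation_le_nonneg)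
  have "S \<subseteq> M"
    unfolding S_def M_def by (rule simple_functions_subset_measurable_functions[OF sigma_algebra_axioms])
  have bdd: "f \<in> bounded_functions Z" if "f \<in> M" for f
    using that by (simp add: M_def measurable_functions_def)
  have dense: "\<exists>s\<in>S. \<forall>z\<in>Z. norm (s z - f z) \<le> \<eta>" if "f \<in> M" "\<eta> > 0" for f \<eta>
    using simple_functions_dense[OF E sigma_algebra_axioms, of f \<eta>] that unfolding M_def S_def by metis
  have "\<forall>f\<in>M. \<exists>L. \<forall>s\<in>S. \<forall>e\<ge>0. (\<forall>z\<in>Z. norm (s z - f z) \<le> e) \<longrightarrow>
      norm (simple_integral Z \<mu> s - L) \<le> e * K"
    unfolding M_def S_def using simple_integral_extends[OF E K] by blast
  then obtain J where J: "\<And>f s e. f \<in> M \<Longrightarrow> s \<in> S \<Longrightarrow> e \<ge> 0 \<Longrightarrow> (\<And>z. z \<in> Z \<Longrightarrow> norm (s z - f z) \<le> e) \<Longrightarrow>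
      norm (simple_integral Z \<mu> s - J f) \<le> e * K"
    by metis
  have J_simple: "J f = simple_integral Z \<mu> f" if "f \<in> S" for f
    using J[of f f 0] that \<open>S \<subseteq> M\<close> by auto
  have J_Lipschitz: "norm (J g - J f) \<le> e * K"
    if fg: "f \<in> M" "g \<in> M" "\<And>z. z \<in> Z \<Longrightarrow> norm (g z - f z) \<le> e" "e \<ge> 0" for f g e
  proof (rule field_le_epsilon)
    fix r :: real assume "r > 0"
    \<comment> \<open>Comparing \<open>J f\<close> and \<open>J g\<close> through one simple
      function costs \<open>\<eta> * K\<close> twice beyond \<open>e * K\<close>.\<close>
    define \<eta> where "\<eta> = r / (2 * (K + 1))"
    have "\<eta> > 0" using \<open>r > 0\<close> \<open>K \<ge> 0\<close> by (simp add: \<eta>_def)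
    then obtain s where s: "s \<in> S" "\<And>z. z \<in> Z \<Longrightarrow> norm (s z - f z) \<le> \<eta>"
      using dense fg by blast
    have "norm (s z - g z) \<le> e + \<eta>" if "z \<in> Z" for z
      using s(2)[OF that] fg(3)[OF that] norm_triangle_ineq4[of "s z - f z" "g z - f z"] by simp
    then have "norm (simple_integral Z \<mu> s - J g) \<le> (e + \<eta>) * K"
      using s fg \<open>\<eta> > 0\<close> by (intro J) auto
    moreover have "norm (simple_integral Z \<mu> s - J f) \<le> \<eta> * K"
      using s fg \<open>\<eta> > 0\<close> by (intro J) auto
    ultimately have "norm (J g - J f) \<le> \<eta> * K + (e + \<eta>) * K"
      using norm_triangle_ineq4[of "simple_integral Z \<mu> s - J f" "simple_integral Z \<mu> s - J g"] by simp
    also have "\<dots> = e * K + 2 * \<eta> * K"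
      by (simp add: algebra_simps)
    also have "2 * \<eta> * K \<le> r"
      using \<open>r > 0\<close> \<open>K \<ge> 0\<close> by (simp add: \<eta>_def field_simps)
    finally show "norm (J g - J f) \<le> e * K + r" by simp
  qed
  have "i_integral sE Z \<MM> \<mu> = restrict J M"
    unfolding i_integral_def M_def[symmetric] S_def[symmetric]
  proof (rule the_equality)
    show "restrict J M \<in> extensional M \<and> sup_norm_continuous_on Z M (restrict J M) \<and>
        (\<forall>f\<in>S. restrict J M f = simple_integral Z \<mu> f)"
    proof (intro conjI ballI)
      show "sup_norm_continuous_on Z M (restrict J M)"
        unfolding sup_norm_continuous_on_def
      proof (intro ballI allI impI)
        fix f \<epsilon> assume f: "f \<in> M" and "(\<epsilon>::real) > 0"
        show "\<exists>\<delta>>0. \<forall>g\<in>M. sup_norm Z (\<lambda>z. g z - f z) < \<delta> \<longrightarrow> norm (restrict J M g - restrict J M f) < \<epsilon>"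
        proof (intro exI[of _ "\<epsilon> / (K + 1)"] conjI ballI impI)
          show "0 < \<epsilon> / (K + 1)" using \<open>\<epsilon> > 0\<close> \<open>K \<ge> 0\<close> by simp
          fix g assume g: "g \<in> M" and lt: "sup_norm Z (\<lambda>z. g z - f z) < \<epsilon> / (K + 1)"
          have "norm (J g - J f) \<le> \<epsilon> / (K + 1) * K"
            using norm_le_sup_norm[OF bdd[OF g] bdd[OF f]] lt f g \<open>\<epsilon> > 0\<close> \<open>K \<ge> 0\<close>
            by (intro J_Lipschitz) (auto intro: order_trans less_imp_le)
          also have "\<dots> < \<epsilon>"
            using \<open>\<epsilon> > 0\<close> \<open>K \<ge> 0\<close> by (simp add: field_simps)
          finally show "norm (restrict J M g - restrict J M f) < \<epsilon>"
            using f g by simp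
        qed
      qed
    qed (use \<open>S \<subseteq> M\<close> J_simple in auto)
  next
    fix I assume "I \<in> extensional M \<and> sup_norm_continuous_on Z M I \<and> (\<forall>f\<in>S. I f = simple_integral Z \<mu> f)"
    then have I: "I \<in> extensional M" "sup_norm_continuous_on Z M I" "\<And>f. f \<in> S \<Longrightarrow> I f = simple_integral Z \<mu> f"
      by auto
    have "I f = J f" if "f \<in> M" for f
    proof -
      have "norm (I f - J f) \<le> 0 + r" if "r > 0" for r
      proof -
        obtain \<delta> where \<delta>: "\<delta> > 0" "\<And>g. g \<in> M \<Longrightarrow> sup_norm Z (\<lambda>z. g z - f z) < \<delta> \<Longrightarrow> norm (I g - I f) < r / 2"
          using I(2) \<open>f \<in> M\<close> \<open>r > 0\<close> unfolding sup_norm_continuous_on_def by (meson half_gt_zero)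
        \<comment> \<open>The first bound brings \<open>s\<close> within the range of continuity of
          \<open>I\<close> at \<open>f\<close>, with factor 1/2 for strictness; the second keeps
          \<open>\<eta> * K\<close> below r/2.\<close>
        define \<eta> where "\<eta> = min (\<delta> / 2) (r / (2 * (K + 1)))"
        have \<eta>: "\<eta> > 0" "\<eta> < \<delta>" "\<eta> * K \<le> r / 2"
        proof -
          show "\<eta> > 0" "\<eta> < \<delta>" using \<open>r > 0\<close> \<open>\<delta> > 0\<close> \<open>K \<ge> 0\<close> by (auto simp: \<eta>_def)
          have "\<eta> * K \<le> r / (2 * (K + 1)) * K"
            using \<open>K \<ge> 0\<close> by (intro mult_right_mono) (auto simp: \<eta>_def)
          also have "\<dots> \<le> r / 2" using \<open>r > 0\<close> \<open>K \<ge> 0\<close> by (simp add: field_simps)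
          finally show "\<eta> * K \<le> r / 2" .
        qed
        obtain s where s: "s \<in> S" "\<And>z. z \<in> Z \<Longrightarrow> norm (s z - f z) \<le> \<eta>"
          using dense \<open>f \<in> M\<close> \<eta>(1) by blast
        then have "sup_norm Z (\<lambda>z. s z - f z) < \<delta>"
          using sup_norm_le[of Z "\<lambda>z. s z - f z" \<eta>] \<eta> by simp
        then have "norm (I s - I f) < r / 2"
          using \<delta>(2) s(1) \<open>S \<subseteq> M\<close> by blast
        moreover have "norm (simple_integral Z \<mu> s - J f) \<le> \<eta> * K"
          using s \<eta> \<open>f \<in> M\<close> by (intro J) auto
        ultimately show "norm (I f - J f) \<le> 0 + r"
          using \<eta>(3) I(3)[OF s(1)] norm_triangle_ineq4[of "I s - J f" "I s - I f"] by simp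
      qed
      then have "norm (I f - J f) \<le> 0" by (rule field_le_epsilon)
      then show ?thesis by simp
    qed
    with I(1) show "I = restrict J M"
      by (auto simp: fun_eq_iff extensional_def)
  qed
  then show ?thesis
    using J[of f s e] assms by (simp add: M_def S_def)
qed

end

theorem theorem4p12:
  fixes sE :: "'k::real_or_complex \<Rightarrow> 'e::banach \<Rightarrow> 'e"
    and sF :: "'k \<Rightarrow> 'f::banach \<Rightarrow> 'f"
    and Z :: "'z set"
    and \<MM> :: "'z set set"
    and \<mu> :: "'z set \<Rightarrow> 'e \<Rightarrow>\<^sub>L 'f"
    and f :: "nat \<Rightarrow> 'z \<Rightarrow> 'e"
    and g :: "'z \<Rightarrow> 'e"
  assumes "normed_space_over sE"
    and "normed_space_over sF"
    and "sigma_algebra Z \<MM>"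
    and "i_measure sE sF \<MM> \<mu>"
    and "\<And>n. f n \<in> measurable_functions sE Z \<MM>"
    and "\<exists>C. \<forall>n. \<forall>z\<in>Z. norm (f n z) \<le> C"
    and "\<And>z. z \<in> Z \<Longrightarrow> (\<lambda>n. f n z) \<longlonglongrightarrow> g z"
  shows "(\<lambda>n. i_integral sE Z \<MM> \<mu> (f n)) \<longlonglongrightarrow> i_integral sE Z \<MM> \<mu> g"
proof -
  note E = assms(1) and f = assms(5) and lim = assms(7)
  interpret operator_measure Z \<MM> \<mu>
  proof (intro operator_measure.intro assms(3) operator_measure_axioms.intro)
    fix A :: "nat \<Rightarrow> 'z set" assume A: "range A \<subseteq> \<MM>" "disjoint_family A"
    show "(\<lambda>n. \<mu> (A n) x) sums \<mu> (\<Union>n. A n) x" for x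
      using assms(4) A by (simp add: i_measure_def)
    show "summable (\<lambda>n. \<mu> (A n) (y n))" if "bounded (range y)" for y
      using assms(4) A that by (simp add: i_measure_def independently_convergent_def)
  qed
  obtain K where K: "semivariation_le Z K" using semivariation_finite by blast
  then have "K \<ge> 0" by (rule semivariation_le_nonneg)
  obtain C where C: "\<And>n z. z \<in> Z \<Longrightarrow> norm (f n z) \<le> C" and "C \<ge> 0"
    using assms(6) by (metis norm_ge_zero order_trans linear)
  have g: "g \<in> measurable_functions sE Z \<MM>"
    using assms(3) f C lim by (rule measurable_functions_pointwise_limit)
  have g_le: "norm (g z) \<le> C" if "z \<in> Z" for z
    using tendsto_norm[OF lim[OF that]] C[OF that] by (intro LIMSEQ_le_const2) auto
  show ?thesis
  proof (rule LIMSEQ_I)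
    fix e :: real assume "e > 0"
    \<comment> \<open>Two approximations by simple functions cost \<open>\<eta> * K\<close> each and
      the part off the exceptional set \<open>3 * \<eta> * K\<close>, in all less than e/2. On the
      exceptional set the simple functions differ by at most \<open>2 * (C + \<eta>)\<close>, and
      \<delta> makes that part e/2.\<close>
    define \<eta> where "\<eta> = e / (10 * (K + 1))"
    define \<delta> where "\<delta> = e / (4 * (C + \<eta>))"
    have "\<eta> > 0" using \<open>e > 0\<close> \<open>K \<ge> 0\<close> by (simp add: \<eta>_def)
    then have "\<delta> > 0" using \<open>e > 0\<close> \<open>C \<ge> 0\<close> by (simp add: \<delta>_def)
    have "\<exists>s. s \<in> simple_functions Z \<MM> \<and> (\<forall>z\<in>Z. norm (s z - f n z) \<le> \<eta>)" for n
      using simple_functions_dense[OF E assms(3) f \<open>\<eta> > 0\<close>] by metis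
    then obtain s where s: "\<And>n. s n \<in> simple_functions Z \<MM>"
        "\<And>n z. z \<in> Z \<Longrightarrow> norm (s n z - f n z) \<le> \<eta>"
      by metis
    obtain t where t: "t \<in> simple_functions Z \<MM>" "\<And>z. z \<in> Z \<Longrightarrow> norm (t z - g z) \<le> \<eta>"
      using simple_functions_dense[OF E assms(3) g \<open>\<eta> > 0\<close>] by metis
    \<comment> \<open>The threshold is \<eta> for each of \<open>s k - f k\<close>,
      \<open>f k - g\<close> and \<open>g - t\<close>. Once \<open>f k z\<close> is within \<eta> of
      \<open>g z\<close>, the point \<open>z\<close> leaves \<open>B k\<close> for good; the tail
      unions \<open>A n\<close> therefore have empty intersection.\<close>
    define B where "B k = {z \<in> Z. norm (s k z - t z) > 3 * \<eta>}" for k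
    define A where "A n = (\<Union>k\<in>{n..}. B k)" for n
    have B: "B k \<in> \<MM>" for k
    proof -
      \<comment> \<open>Both functions have countably many values, so \<open>B k\<close> is a
        countable union of joint level sets.\<close>
      define P where "P = {p \<in> s k ` Z \<times> t ` Z. norm (fst p - snd p) > 3 * \<eta>}"
      have "countable P"
      proof (rule countable_subset)
        show "P \<subseteq> s k ` Z \<times> t ` Z" by (auto simp: P_def)
        show "countable (s k ` Z \<times> t ` Z)"
          using s(1)[of k] t(1) by (auto simp: simple_functions_def)
      qed
      moreover have "(s k -` {fst p} \<inter> Z) \<inter> (t -` {snd p} \<inter> Z) \<in> \<MM>" for p
        using s(1)[of k] t(1) by (intro Int[of "_ \<inter> Z"]) (simp_all add: simple_functions_def)
      ultimately have "(\<Union>p\<in>P. (s k -` {fst p} \<inter> Z) \<inter> (t -` {snd p} \<inter> Z)) \<in> \<MM>"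
        by (intro countable_UN'')
      also have "(\<Union>p\<in>P. (s k -` {fst p} \<inter> Z) \<inter> (t -` {snd p} \<inter> Z)) = B k"
        by (force simp: P_def B_def)
      finally show ?thesis .
    qed
    have "range A \<subseteq> \<MM>"
      using B by (auto simp: A_def intro!: countable_UN'')
    moreover have "decseq A"
      unfolding A_def decseq_def by (intro allI impI UN_mono) auto
    moreover have "(\<Inter>n. A n) = {}"
    proof (rule equals0I)
      fix z assume z: "z \<in> (\<Inter>n. A n)"
      then have "z \<in> Z" by (auto simp: A_def B_def)
      then obtain N where N: "\<And>n. n \<ge> N \<Longrightarrow> norm (f n z - g z) < \<eta>"
        using LIMSEQ_D[OF lim \<open>\<eta> > 0\<close>] by metis
      obtain k where k: "k \<ge> N" "norm (s k z - t z) > 3 * \<eta>"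
        using z by (auto simp: A_def B_def)
      have "s k z - t z = (s k z - f k z) + (f k z - g z) - (t z - g z)" by simp
      then have "norm (s k z - t z) \<le> norm (s k z - f k z) + norm (f k z - g z) + norm (t z - g z)"
        by (metis norm_triangle_ineq norm_triangle_ineq4 order_trans add_right_mono)
      with k(2) N[OF k(1)] s(2)[OF \<open>z \<in> Z\<close>, of k] t(2)[OF \<open>z \<in> Z\<close>] show False
        by linarith
    qed
    ultimately obtain N where N: "semivariation_le (A N) \<delta>"
      using semivariation_continuous \<open>\<delta> > 0\<close> by blast
    have "norm (i_integral sE Z \<MM> \<mu> (f n) - i_integral sE Z \<MM> \<mu> g) < e" if "n \<ge> N" for n
    proof -
      define i where "i = simple_integral Z \<mu>"
      have "norm (i (s n) - i t) \<le> (3 * \<eta>) * K + (2 * (C + \<eta>)) * \<delta>"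
        unfolding i_def
      proof (rule simple_integral_diff_le[OF s(1) t(1) _ _ _ _ _ K N])
        show "A N \<in> \<MM>" using \<open>range A \<subseteq> \<MM>\<close> by blast
        show "norm (s n z - t z) \<le> 3 * \<eta>" if "z \<in> Z - A N" for z
          using that \<open>n \<ge> N\<close> by (auto simp: A_def B_def not_less)
        show "norm (s n z - t z) \<le> 2 * (C + \<eta>)" if "z \<in> A N" for z
        proof -
          have "z \<in> Z" using that by (auto simp: A_def B_def)
          then show ?thesis
            using s(2)[of z n] t(2)[of z] C[of z n] g_le[of z] norm_triangle_ineq4[of "s n z" "t z"]
              norm_triangle_sub[of "s n z" "f n z"] norm_triangle_sub[of "t z" "g z"] by simp
        qed
      qed (use \<open>\<eta> > 0\<close> \<open>C \<ge> 0\<close> in auto)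
      also have "(2 * (C + \<eta>)) * \<delta> = e / 2"
      proof -
        have "(2 * d) * (e / (4 * d)) = e / 2" if "d > 0" for d :: real
          using that by (simp add: field_simps)
        from this[of "C + \<eta>"] show ?thesis
          unfolding \<delta>_def using \<open>\<eta> > 0\<close> \<open>C \<ge> 0\<close> by simp
      qed
      finally have "norm (i (s n) - i t) \<le> 3 * \<eta> * K + e / 2" .
      moreover have "norm (i (s n) - i_integral sE Z \<MM> \<mu> (f n)) \<le> \<eta> * K"
        unfolding i_def using s f \<open>\<eta> > 0\<close> by (intro i_integral_approx[OF E K]) auto
      moreover have "norm (i t - i_integral sE Z \<MM> \<mu> g) \<le> \<eta> * K"
        unfolding i_def using t g \<open>\<eta> > 0\<close> by (intro i_integral_approx[OF E K]) auto
      moreover have "norm (i_integral sE Z \<MM> \<mu> (f n) - i_integral sE Z \<MM> \<mu> g) \<le>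
          norm (i (s n) - i_integral sE Z \<MM> \<mu> (f n)) + norm (i (s n) - i t) +
          norm (i t - i_integral sE Z \<MM> \<mu> g)"
        by norm
      moreover have "5 * (\<eta> * K) < e / 2"
        using \<open>e > 0\<close> \<open>K \<ge> 0\<close> by (simp add: \<eta>_def field_simps)
      ultimately show ?thesis by linarith
    qed
    then show "\<exists>N. \<forall>n\<ge>N. norm (i_integral sE Z \<MM> \<mu> (f n) - i_integral sE Z \<MM> \<mu> g) < e"
      by blast
  qed
qed

end
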